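(* Let $\Omega\subset\mathbb R^2$ be a strictly convex bounded planar domain with smooth boundary of length $\ell$ and everywhere positive curvature $k(s)$, where $s$ is the arc-length parameter. Define $$x(s)=\frac1L\int_0^s k^{2/3}(r)\,dr,\qquad L:=\int_0^{\ell}k^{2/3}(r)\,dr,\qquad y(s,\varepsilon)=x(s+\varepsilon)-x(s).$$ Then in the coordinates $(x,y)$ the outer length billiard dynamics around $\Omega$ is given by $$x\mapsto x+y,\qquad y\mapsto y+O(y^4)\qquad (y\to0^+).$$
   Context: Let $\gamma$ be the $\ell$-periodic counter-clockwise arc-length parametrization of $\partial\Omega$. For each $s$ let $s^*\in(s,s+\ell)$ be the unique parameter such that the tangent lines at $\gamma(s)$ and $\gamma(s^* )$ are parallel. The outer length billiard map is $T:(s_0,\varepsilon_0)\mapsto(s_1,\varepsilon_1)$ on $\{(s,\varepsilon):0<\varepsilon<s^*-s\}$, where $s_1=s_0+\varepsilon_0$, $\varepsilon_1=s_2-s_1$, and $s_2$ is defined as follows. Let $P$ be the intersection of the tangent lines to $\partial\Omega$ at $\gamma(s_0)$ and $\gamma(s_1)$. Consider the circle in $\mathbb R^2\setminus\Omega$ tangent to $\partial\Omega$ at $\gamma(s_1)$ and tangent to the line $P\gamma(s_0)$. This circle and $\partial\Omega$ have one further common tangent line, other than the tangent lines to $\partial\Omega$ at $\gamma(s_0)$ and $\gamma(s_1)$; it touches $\partial\Omega$ at $\gamma(s_2)$, with $s_1<s_2<s_1^*$. *)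

theory Defs
  imports "HOL-Analysis.Analysis"
begin

section \<open>Strictly convex planar domains with smooth boundary\<close>

definition strictly_convex :: "'a::euclidean_space set \<Rightarrow> bool" where
  "strictly_convex S \<longleftrightarrow>
     (\<forall>x\<in>closure S. \<forall>y\<in>closure S. open_segment x y \<subseteq> interior S)"

definition smooth_curve :: "(real \<Rightarrow> real^2) \<Rightarrow> bool" where
  "smooth_curve \<gamma> \<longleftrightarrow>
     (\<exists>D :: nat \<Rightarrow> real \<Rightarrow> real^2. D 0 = \<gamma> \<and>
        (\<forall>n s. (D n has_vector_derivative D (Suc n) s) (at s)))"

definition rot90 :: "real^2 \<Rightarrow> real^2" where
  "rot90 v = vector [- v$2, v$1]"

definition unit_tangent :: "(real \<Rightarrow> real^2) \<Rightarrow> real \<Rightarrow> real^2" where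
  "unit_tangent \<gamma> s = vector_derivative \<gamma> (at s)"

text \<open>Signed curvature of an arc-length parametrized curve, with respect to the left normal.\<close>

definition curvature :: "(real \<Rightarrow> real^2) \<Rightarrow> real \<Rightarrow> real" where
  "curvature \<gamma> s = vector_derivative (unit_tangent \<gamma>) (at s) \<bullet> rot90 (unit_tangent \<gamma> s)"

text \<open>
  Since \<open>\<gamma>\<close> has unit speed and runs through the boundary exactly once on \<open>{0..<\<l>}\<close>,
  the number \<open>\<l>\<close> is the length of the boundary. The last conjunct says that \<open>\<Omega>\<close>
  lies locally to the left of \<open>\<gamma>\<close>, i.e. that \<open>\<gamma>\<close> runs counter-clockwise.
\<close>

definition ccw_arclength_boundary ::
    "(real^2) set \<Rightarrow> real \<Rightarrow> (real \<Rightarrow> real^2) \<Rightarrow> bool" where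
  "ccw_arclength_boundary \<Omega> \<l> \<gamma> \<longleftrightarrow>
     0 < \<l> \<and> smooth_curve \<gamma> \<and>
     (\<forall>s. norm (unit_tangent \<gamma> s) = 1) \<and>
     (\<forall>s. \<gamma> (s + \<l>) = \<gamma> s) \<and> inj_on \<gamma> {0..<\<l>} \<and>
     range \<gamma> = frontier \<Omega> \<and>
     (\<forall>s. \<forall>\<^sub>F t in at_right 0. \<gamma> s + t *\<^sub>R rot90 (unit_tangent \<gamma> s) \<in> \<Omega>)"


section \<open>The outer length billiard map\<close>

definition tangent_line :: "(real \<Rightarrow> real^2) \<Rightarrow> real \<Rightarrow> (real^2) set" where
  "tangent_line \<gamma> s = range (\<lambda>t. \<gamma> s + t *\<^sub>R unit_tangent \<gamma> s)"

text \<open>The parameter \<open>s\<^sup>*\<close>.\<close>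

definition antipode :: "real \<Rightarrow> (real \<Rightarrow> real^2) \<Rightarrow> real \<Rightarrow> real" where
  "antipode \<l> \<gamma> s =
     (THE s'. s < s' \<and> s' < s + \<l> \<and> (\<exists>c. unit_tangent \<gamma> s' = c *\<^sub>R unit_tangent \<gamma> s))"

text \<open>For a line \<open>K\<close> and \<open>r > 0\<close> only.\<close>

definition tangent_to_circle :: "(real^2) set \<Rightarrow> real^2 \<Rightarrow> real \<Rightarrow> bool" where
  "tangent_to_circle K c r \<longleftrightarrow> (\<exists>!q. q \<in> K \<inter> sphere c r)"

text \<open>
  The circle with centre \<open>c\<close> and radius \<open>r\<close> that determines \<open>s\<^sub>2\<close>. That it lies in the
  complement of \<open>\<Omega>\<close> is stated for the disc: a circle enclosing \<open>\<Omega>\<close> is not admitted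
  (for instance the boundary itself if \<open>\<Omega>\<close> is a disc).
\<close>

definition outer_circle ::
    "(real^2) set \<Rightarrow> (real \<Rightarrow> real^2) \<Rightarrow> real \<Rightarrow> real \<Rightarrow> real^2 \<Rightarrow> real \<Rightarrow> bool" where
  "outer_circle \<Omega> \<gamma> s\<^sub>0 s\<^sub>1 c r \<longleftrightarrow>
     0 < r \<and> cball c r \<inter> \<Omega> = {} \<and>
     tangent_line \<gamma> s\<^sub>1 \<inter> sphere c r = {\<gamma> s\<^sub>1} \<and>
     (\<exists>P. tangent_line \<gamma> s\<^sub>0 \<inter> tangent_line \<gamma> s\<^sub>1 = {P} \<and> P \<noteq> \<gamma> s\<^sub>0 \<and>
        tangent_to_circle (affine hull {P, \<gamma> s\<^sub>0}) c r)"

definition next_tangency ::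
    "(real^2) set \<Rightarrow> real \<Rightarrow> (real \<Rightarrow> real^2) \<Rightarrow> real \<Rightarrow> real \<Rightarrow> real \<Rightarrow> bool" where
  "next_tangency \<Omega> \<l> \<gamma> s\<^sub>0 s\<^sub>1 s\<^sub>2 \<longleftrightarrow>
     s\<^sub>1 < s\<^sub>2 \<and> s\<^sub>2 < antipode \<l> \<gamma> s\<^sub>1 \<and>
     tangent_line \<gamma> s\<^sub>2 \<noteq> tangent_line \<gamma> s\<^sub>0 \<and> tangent_line \<gamma> s\<^sub>2 \<noteq> tangent_line \<gamma> s\<^sub>1 \<and>
     (\<exists>c r. outer_circle \<Omega> \<gamma> s\<^sub>0 s\<^sub>1 c r \<and> tangent_to_circle (tangent_line \<gamma> s\<^sub>2) c r)"

definition phase_space :: "real \<Rightarrow> (real \<Rightarrow> real^2) \<Rightarrow> (real \<times> real) set" where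
  "phase_space \<l> \<gamma> = {(s, \<epsilon>). 0 < \<epsilon> \<and> \<epsilon> < antipode \<l> \<gamma> s - s}"

definition outer_length_map ::
    "(real^2) set \<Rightarrow> real \<Rightarrow> (real \<Rightarrow> real^2) \<Rightarrow> real \<times> real \<Rightarrow> real \<times> real" where
  "outer_length_map \<Omega> \<l> \<gamma> =
     (\<lambda>(s\<^sub>0, \<epsilon>\<^sub>0). let s\<^sub>1 = s\<^sub>0 + \<epsilon>\<^sub>0; s\<^sub>2 = (THE s\<^sub>2. next_tangency \<Omega> \<l> \<gamma> s\<^sub>0 s\<^sub>1 s\<^sub>2)
       in (s\<^sub>1, s\<^sub>2 - s\<^sub>1))"


section \<open>The coordinates\<close>

definition x_coord :: "real \<Rightarrow> (real \<Rightarrow> real^2) \<Rightarrow> real \<Rightarrow> real" where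
  "x_coord \<l> \<gamma> s =
     (LBINT r=0..s. curvature \<gamma> r powr (2/3)) / (LBINT r=0..\<l>. curvature \<gamma> r powr (2/3))"

definition y_coord :: "real \<Rightarrow> (real \<Rightarrow> real^2) \<Rightarrow> real \<Rightarrow> real \<Rightarrow> real" where
  "y_coord \<l> \<gamma> s \<epsilon> = x_coord \<l> \<gamma> (s + \<epsilon>) - x_coord \<l> \<gamma> s"

definition xy_coords :: "real \<Rightarrow> (real \<Rightarrow> real^2) \<Rightarrow> real \<times> real \<Rightarrow> real \<times> real" where
  "xy_coords \<l> \<gamma> = (\<lambda>(s, \<epsilon>). (x_coord \<l> \<gamma> s, y_coord \<l> \<gamma> s \<epsilon>))"

end

theory Submission
  imports Defs
begin

text \<open>
  For parameters \<open>s\<close>, \<open>t\<close> let \<open>R s t\<close> be the radius of the outer circle that touches the boundary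
  at \<open>\<gamma> s\<close> and is also tangent to the tangent line at \<open>\<gamma> t\<close>. With the inner normal \<open>n\<close> and the
  tangent \<open>T\<close> it equals \<open>((\<gamma> s - \<gamma> t) \<bullet> n t) / (1 + T s \<bullet> T t)\<close>, and \<open>s\<^sub>2\<close> is the solution of
  \<open>R s\<^sub>1 s\<^sub>2 = R s\<^sub>1 s\<^sub>0\<close> beyond \<open>s\<^sub>1\<close>. It exists and is unique because \<open>R s\<^sub>1\<close> increases from \<open>0\<close> to infinity
  between \<open>s\<^sub>1\<close> and its antipode; the sign of the derivative comes from the support lines of \<open>\<Omega>\<close>.

  Let \<open>X\<close> be the integral of \<open>k powr (2/3)\<close> from \<open>s\<close> to \<open>t\<close>. Uniformly in \<open>s\<close>, the radius expands as
  \<open>A * X^2 + B * X^4 + O(X^5)\<close>: the exponent \<open>2/3\<close> is exactly what removes the cubic term. Hence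
  \<open>R s\<^sub>1 s\<^sub>2 = R s\<^sub>1 s\<^sub>0\<close> forces the two values of \<open>X\<close> to be opposite up to a fourth-order error.
\<close>

section \<open>Uniform order estimates\<close>

text \<open>Both neighbours are viewed from the middle parameter \<open>s\<^sub>1\<close>, at
  offsets of opposite sign, so they share the coefficients \<open>A\<close> and \<open>B\<close> and
  only parity in \<open>X\<close> is left to exploit. The exponent is forced by the first two terms:
  at offset \<open>t\<close> the radius begins with \<open>k/4 * t^2 + k'/6 * t^3\<close>, the
  square of \<open>X\<close> with \<open>w^2 * t^2 + w * w' * t^3\<close> for a weight
  \<open>w\<close>; these are proportional precisely when \<open>w'/w = (2/3) * (k'/k)\<close>. A
  fifth-order remainder is enough for a fourth-order error because the difference of the two even
  quartics contains a first-order factor, the sum of the two lengths, which is divided out.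

  Two obstacles shape the estimates. One constant has to serve all base points, so every coefficient
  is bounded on the whole line, which periodicity of the curvature supplies. And equal radii alone
  do not say that \<open>s\<^sub>2\<close> is near \<open>s\<^sub>1\<close>, where the expansion
  applies; monotonicity of the radius rules out a distant solution.\<close>

definition unif_bigo :: "nat \<Rightarrow> (real \<Rightarrow> real \<Rightarrow> real) \<Rightarrow> bool" where
  "unif_bigo n F \<longleftrightarrow> (\<exists>C. \<forall>s t. \<bar>t\<bar> \<le> 1 \<longrightarrow> \<bar>F s t\<bar> \<le> C * \<bar>t\<bar> ^ n)"

lemma unif_bigoI: "(\<And>s t. \<bar>t\<bar> \<le> 1 \<Longrightarrow> \<bar>F s t\<bar> \<le> C * \<bar>t\<bar> ^ n) \<Longrightarrow> unif_bigo n F"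
  unfolding unif_bigo_def by blast

lemma unif_bigoE:
  assumes "unif_bigo n F"
  obtains C where "0 \<le> C" "\<And>s t. \<bar>t\<bar> \<le> 1 \<Longrightarrow> \<bar>F s t\<bar> \<le> C * \<bar>t\<bar> ^ n"
proof -
  obtain C where C: "\<And>s t. \<bar>t\<bar> \<le> 1 \<Longrightarrow> \<bar>F s t\<bar> \<le> C * \<bar>t\<bar> ^ n"
    using assms unfolding unif_bigo_def by blast
  have "0 \<le> C" using C[of 1 0] by (auto intro: order_trans[OF abs_ge_zero])
  then show thesis using C that by blast
qed

lemma unif_bigo_add:
  assumes "unif_bigo n F" "unif_bigo n G"
  shows "unif_bigo n (\<lambda>s t. F s t + G s t)"
proof -
  obtain C where C: "\<And>s t. \<bar>t\<bar> \<le> 1 \<Longrightarrow> \<bar>F s t\<bar> \<le> C * \<bar>t\<bar> ^ n" using assms(1) by (rule unif_bigoE) blast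
  obtain D where D: "\<And>s t. \<bar>t\<bar> \<le> 1 \<Longrightarrow> \<bar>G s t\<bar> \<le> D * \<bar>t\<bar> ^ n" using assms(2) by (rule unif_bigoE) blast
  show ?thesis
  proof (rule unif_bigoI[where C = "C + D"])
    fix s t :: real assume "\<bar>t\<bar> \<le> 1"
    then show "\<bar>F s t + G s t\<bar> \<le> (C + D) * \<bar>t\<bar> ^ n"
      using C[of t s] D[of t s] by (simp add: distrib_right)
  qed
qed

lemma unif_bigo_mult:
  assumes "unif_bigo m F" "unif_bigo n G"
  shows "unif_bigo (m + n) (\<lambda>s t. F s t * G s t)"
proof -
  obtain C where C: "0 \<le> C" "\<And>s t. \<bar>t\<bar> \<le> 1 \<Longrightarrow> \<bar>F s t\<bar> \<le> C * \<bar>t\<bar> ^ m"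
    using assms(1) by (rule unif_bigoE) blast
  obtain D where D: "\<And>s t. \<bar>t\<bar> \<le> 1 \<Longrightarrow> \<bar>G s t\<bar> \<le> D * \<bar>t\<bar> ^ n" using assms(2) by (rule unif_bigoE) blast
  show ?thesis
  proof (rule unif_bigoI[where C = "C * D"])
    fix s t :: real assume t: "\<bar>t\<bar> \<le> 1"
    have "\<bar>F s t\<bar> * \<bar>G s t\<bar> \<le> (C * \<bar>t\<bar> ^ m) * (D * \<bar>t\<bar> ^ n)"
      by (rule mult_mono[OF C(2)[OF t] D[OF t]]) (use C(1) in auto)
    then show "\<bar>F s t * G s t\<bar> \<le> C * D * \<bar>t\<bar> ^ (m + n)"
      by (simp add: abs_mult power_add algebra_simps)
  qed
qed

lemma unif_bigo_multI:
  "unif_bigo m F \<Longrightarrow> unif_bigo n G \<Longrightarrow> m + n = l \<Longrightarrow> unif_bigo l (\<lambda>s t. F s t * G s t)"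
  using unif_bigo_mult by blast

lemma unif_bigo_mono:
  assumes "unif_bigo m F" "n \<le> m"
  shows "unif_bigo n F"
proof -
  obtain C where C: "0 \<le> C" "\<And>s t. \<bar>t\<bar> \<le> 1 \<Longrightarrow> \<bar>F s t\<bar> \<le> C * \<bar>t\<bar> ^ m"
    using assms(1) by (rule unif_bigoE) blast
  show ?thesis
  proof (rule unif_bigoI[where C = C])
    fix s t :: real assume t: "\<bar>t\<bar> \<le> 1"
    have "\<bar>t\<bar> ^ m \<le> \<bar>t\<bar> ^ n" by (rule power_decreasing) (use assms(2) t in auto)
    then show "\<bar>F s t\<bar> \<le> C * \<bar>t\<bar> ^ n"
      using C(2)[OF t, of s] mult_left_mono[OF _ C(1)] by (meson order_trans)
  qed
qed

lemma unif_bigo_power: "unif_bigo n (\<lambda>s t. t ^ n)"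
  by (rule unif_bigoI[where C = 1]) (simp add: power_abs)

section \<open>Bounded coefficient functions\<close>

definition bounded_fun :: "(real \<Rightarrow> real) \<Rightarrow> bool" where
  "bounded_fun a \<longleftrightarrow> (\<exists>C. \<forall>s. \<bar>a s\<bar> \<le> C)"

lemma unif_bigo_const: "bounded_fun a \<Longrightarrow> unif_bigo 0 (\<lambda>s t. a s)"
  unfolding bounded_fun_def unif_bigo_def by simp

lemma unif_bigo_shift: "bounded_fun a \<Longrightarrow> unif_bigo 0 (\<lambda>s t. a (s + t))"
  unfolding bounded_fun_def unif_bigo_def by (metis mult.right_neutral power_0)

lemma unif_bigo_term: "bounded_fun a \<Longrightarrow> n \<le> m \<Longrightarrow> unif_bigo n (\<lambda>s t. a s * t ^ m)"
  using unif_bigo_mono[OF unif_bigo_mult[OF unif_bigo_const unif_bigo_power[of m]]] by simp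

lemma bounded_fun_const [simp]: "bounded_fun (\<lambda>s. c)"
  unfolding bounded_fun_def by blast

lemma bounded_fun_mult:
  assumes "bounded_fun a" "bounded_fun b"
  shows "bounded_fun (\<lambda>s. a s * b s)"
proof -
  obtain C where C: "\<And>s. \<bar>a s\<bar> \<le> C" using assms(1) unfolding bounded_fun_def by blast
  obtain D where D: "\<And>s. \<bar>b s\<bar> \<le> D" using assms(2) unfolding bounded_fun_def by blast
  have "\<bar>a s * b s\<bar> \<le> C * D" for s
    unfolding abs_mult by (rule mult_mono[OF C D]) (use C[of s] in auto)
  then show ?thesis unfolding bounded_fun_def by blast
qed

lemma bounded_fun_add:
  assumes "bounded_fun a" "bounded_fun b"
  shows "bounded_fun (\<lambda>s. a s + b s)"
proof -
  obtain C where C: "\<And>s. \<bar>a s\<bar> \<le> C" using assms(1) unfolding bounded_fun_def by blast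
  obtain D where D: "\<And>s. \<bar>b s\<bar> \<le> D" using assms(2) unfolding bounded_fun_def by blast
  have "\<bar>a s + b s\<bar> \<le> C + D" for s using C[of s] D[of s] by linarith
  then show ?thesis unfolding bounded_fun_def by blast
qed

lemma bounded_fun_power: "bounded_fun a \<Longrightarrow> bounded_fun (\<lambda>s. a s ^ n)"
  by (induction n) (auto intro: bounded_fun_mult)

lemma bounded_fun_diff: "bounded_fun a \<Longrightarrow> bounded_fun b \<Longrightarrow> bounded_fun (\<lambda>s. a s - b s)"
  using bounded_fun_add[OF _ bounded_fun_mult[OF bounded_fun_const[of "-1"]], of a b] by simp

lemma bounded_fun_divide:
  assumes "bounded_fun a" "0 < c" "\<And>s. c \<le> b s"
  shows "bounded_fun (\<lambda>s. a s / b s)"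
proof -
  have "\<bar>inverse (b s)\<bar> \<le> inverse c" for s
    using assms(2) assms(3)[of s] by (simp add: field_simps)
  then have "bounded_fun (\<lambda>s. inverse (b s))" unfolding bounded_fun_def by blast
  then show ?thesis using bounded_fun_mult[OF assms(1)] by (simp add: divide_inverse)
qed

lemma bounded_fun_divide_const:
  assumes "bounded_fun a"
  shows "bounded_fun (\<lambda>s. a s / c)"
  using bounded_fun_mult[OF assms bounded_fun_const[of "inverse c"]] by (simp add: divide_inverse)

lemma unif_bigo_minus: "unif_bigo n F \<Longrightarrow> unif_bigo n (\<lambda>s t. - F s t)"
  unfolding unif_bigo_def by simp

lemma unif_bigo_diff:
  "unif_bigo n F \<Longrightarrow> unif_bigo n G \<Longrightarrow> unif_bigo n (\<lambda>s t. F s t - G s t)"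
  using unif_bigo_add[OF _ unif_bigo_minus] by fastforce

section \<open>Raising the order by integration\<close>

lemma has_vector_derivative_shift:
  assumes "(f has_vector_derivative f') (at (s + t))"
  shows "((\<lambda>t. f (s + t)) has_vector_derivative f') (at t)"
proof -
  have "((+) s has_vector_derivative 1) (at t)" by (auto intro!: derivative_eq_intros)
  from vector_diff_chain_at[OF this assms] show ?thesis by (simp add: o_def)
qed

lemma has_real_derivative_shift:
  fixes f :: "real \<Rightarrow> real"
  assumes "(f has_real_derivative f') (at (s + t))"
  shows "((\<lambda>t. f (s + t)) has_real_derivative f') (at t)"
  using DERIV_shift[of f f' t s] assms by (simp add: add.commute)

lemma has_real_derivative_inner:
  assumes "(u has_vector_derivative u') (at t)" "(v has_vector_derivative v') (at t)"
  shows "((\<lambda>t. u t \<bullet> v t) has_real_derivative (u t \<bullet> v' + u' \<bullet> v t)) (at t)"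
  using has_derivative_inner[OF assms[unfolded has_vector_derivative_def]]
  unfolding has_field_derivative_def
  by (auto simp: algebra_simps fun_eq_iff elim!: has_derivative_eq_rhs)

text \<open>The mean value bound between \<open>0\<close> and \<open>t\<close>. This is the engine
  of all expansions below: subtract the expected polynomial, differentiate, and estimate the
  derivative one order lower.\<close>

lemma unif_bigo_integrate:
  assumes der: "\<And>s t. (F s has_real_derivative F' s t) (at t)"
    and zero: "\<And>s. F s 0 = 0" and bo: "unif_bigo n F'"
  shows "unif_bigo (Suc n) F"
proof -
  obtain C where C: "0 \<le> C" "\<And>s t. \<bar>t\<bar> \<le> 1 \<Longrightarrow> \<bar>F' s t\<bar> \<le> C * \<bar>t\<bar> ^ n"
    using bo by (rule unif_bigoE) blast
  show ?thesis
  proof (rule unif_bigoI[where C = C])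
    fix s t :: real assume t: "\<bar>t\<bar> \<le> 1"
    have "norm (F s t - F s 0) \<le> (C * \<bar>t\<bar> ^ n) * norm (t - 0)"
    \<comment> \<open>The ball is convex and contains both \<open>0\<close> and \<open>t\<close>, so
      positive and negative \<open>t\<close> need no separate treatment.\<close>
    proof (rule field_differentiable_bound[where S = "cball 0 \<bar>t\<bar>" and f' = "F' s"])
      fix z :: real assume z: "z \<in> cball 0 \<bar>t\<bar>"
      then have "\<bar>z\<bar> \<le> \<bar>t\<bar>" by (simp add: dist_real_def)
      then have "\<bar>F' s z\<bar> \<le> C * \<bar>z\<bar> ^ n" and "\<bar>z\<bar> ^ n \<le> \<bar>t\<bar> ^ n"
        using C(2)[of z s] t by (auto intro: power_mono)
      then show "norm (F' s z) \<le> C * \<bar>t\<bar> ^ n"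
        using mult_left_mono[OF _ C(1)] by (metis order_trans real_norm_def)
      show "(F s has_field_derivative F' s z) (at z within cball 0 \<bar>t\<bar>)"
        using der by (rule DERIV_subset) simp
    qed (auto simp: dist_real_def)
    then show "\<bar>F s t\<bar> \<le> C * \<bar>t\<bar> ^ Suc n" by (simp add: zero mult_ac)
  qed
qed

lemma unif_bigo_taylor3:
  fixes a :: "real \<Rightarrow> real"
  assumes a: "\<And>s. (a has_real_derivative a1 s) (at s)"
    and a1: "\<And>s. (a1 has_real_derivative a2 s) (at s)"
    and a2: "\<And>s. (a2 has_real_derivative a3 s) (at s)"
    and bd: "bounded_fun a3"
  shows "unif_bigo 3 (\<lambda>s t. a (s + t) - (a s + a1 s * t + a2 s / 2 * t\<^sup>2))"
proof -
  note sh = has_real_derivative_shift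
  have "unif_bigo (Suc 0) (\<lambda>s t. a2 (s + t) - a2 s)"
    by (rule unif_bigo_integrate[where F' = "\<lambda>s t. a3 (s + t)"])
      (auto intro!: derivative_eq_intros sh[OF a2] unif_bigo_shift bd)
  then have "unif_bigo (Suc (Suc 0)) (\<lambda>s t. a1 (s + t) - (a1 s + a2 s * t))"
    by (rule unif_bigo_integrate[where F' = "\<lambda>s t. a2 (s + t) - a2 s", rotated 2])
      (auto intro!: derivative_eq_intros sh[OF a1])
  then have "unif_bigo (Suc (Suc (Suc 0))) (\<lambda>s t. a (s + t) - (a s + a1 s * t + a2 s / 2 * t\<^sup>2))"
    by (rule unif_bigo_integrate[where F' = "\<lambda>s t. a1 (s + t) - (a1 s + a2 s * t)", rotated 2])
      (auto intro!: derivative_eq_intros sh[OF a])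
  then show ?thesis by (simp add: numeral_3_eq_3)
qed

section \<open>Fourth-order expansion of the tangent circle\<close>

text \<open>The difference of the quartics factors as
  \<open>(X - Y) * (X + Y) * (A + B * (X^2 + Y^2))\<close>. Smallness of \<open>X\<close> and
  \<open>Y\<close> keeps the last factor above \<open>a / 2\<close>, and the middle one cancels
  against the \<open>X + Y\<close> in the error bound, which is stated in that form for this
  purpose.\<close>

lemma quartic_separation:
  fixes X Y a b A B e :: real
  assumes "0 < X" "0 < Y" "0 < a" "a \<le> A" "\<bar>B\<bar> \<le> b" "b * (X\<^sup>2 + Y\<^sup>2) \<le> a / 2"
    and le: "\<bar>(A * X\<^sup>2 + B * X ^ 4) - (A * Y\<^sup>2 + B * Y ^ 4)\<bar> \<le> e * (X + Y)"
  shows "\<bar>X - Y\<bar> \<le> 2 * e / a"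
proof -
  have "\<bar>B * (X\<^sup>2 + Y\<^sup>2)\<bar> \<le> b * (X\<^sup>2 + Y\<^sup>2)"
    unfolding abs_mult using assms(5) by (auto intro: mult_right_mono)
  then have low: "a / 2 \<le> A + B * (X\<^sup>2 + Y\<^sup>2)" using assms(4,6) by linarith
  have "(A * X\<^sup>2 + B * X ^ 4) - (A * Y\<^sup>2 + B * Y ^ 4)
      = (X - Y) * (X + Y) * (A + B * (X\<^sup>2 + Y\<^sup>2))"
    by (simp add: algebra_simps power2_eq_square power4_eq_xxxx)
  then have "\<bar>X - Y\<bar> * (A + B * (X\<^sup>2 + Y\<^sup>2)) * (X + Y) \<le> e * (X + Y)"
    using le low assms(1-3) by (simp add: abs_mult mult_ac)
  then have "\<bar>X - Y\<bar> * (A + B * (X\<^sup>2 + Y\<^sup>2)) \<le> e" using assms(1,2) by simp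
  moreover have "\<bar>X - Y\<bar> * (a / 2) \<le> \<bar>X - Y\<bar> * (A + B * (X\<^sup>2 + Y\<^sup>2))"
    using low by (intro mult_left_mono) auto
  ultimately show ?thesis using assms(3) by (simp add: field_simps)
qed

text \<open>
  For the tangents at \<open>g s\<close> and \<open>g (s + t)\<close>, the circle touching the first one at \<open>g s\<close>
  and also touching the second one has radius \<open>gap s t / denom s t\<close>.
  The functions \<open>w\<close>, \<open>w1\<close>, \<open>w2\<close>, \<open>w3\<close> stand for \<open>k powr (2/3)\<close> and its derivatives;
  of the exponent only \<open>w1 / w = (2/3) * (k1 / k)\<close> is needed.
\<close>

locale frenet_curve =
  fixes g T n :: "real \<Rightarrow> 'a::real_inner" and k k1 k2 k3 w w1 w2 w3 W :: "real \<Rightarrow> real"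
    and kmin wmin :: real
  assumes g_der: "(g has_vector_derivative T s) (at s)"
    and T_der: "(T has_vector_derivative k s *\<^sub>R n s) (at s)"
    and n_der: "(n has_vector_derivative - k s *\<^sub>R T s) (at s)"
    and T_T: "T s \<bullet> T s = 1" and n_n: "n s \<bullet> n s = 1" and T_n: "T s \<bullet> n s = 0"
    and k_der: "(k has_real_derivative k1 s) (at s)"
    and k1_der: "(k1 has_real_derivative k2 s) (at s)"
    and k2_der: "(k2 has_real_derivative k3 s) (at s)"
    and w_der: "(w has_real_derivative w1 s) (at s)"
    and w1_der: "(w1 has_real_derivative w2 s) (at s)"
    and w2_der: "(w2 has_real_derivative w3 s) (at s)"
    and W_der: "(W has_real_derivative w s) (at s)"
    and k_bd: "bounded_fun k" and k1_bd: "bounded_fun k1" and k2_bd: "bounded_fun k2"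
    and k3_bd: "bounded_fun k3"
    and w_bd: "bounded_fun w" and w1_bd: "bounded_fun w1" and w2_bd: "bounded_fun w2"
    and w3_bd: "bounded_fun w3"
    and kmin: "0 < kmin" "kmin \<le> k s" and wmin: "0 < wmin" "wmin \<le> w s"
    and w1_k: "3 * w1 s * k s = 2 * w s * k1 s"
begin

section \<open>The circle data and their Taylor expansions\<close>

definition gap :: "real \<Rightarrow> real \<Rightarrow> real" where
  "gap s t = (g s - g (s + t)) \<bullet> n (s + t)"

text \<open>The other component of the chord in the frame at \<open>s + t\<close>. It is tracked
  because \<open>gap\<close> and \<open>lead\<close> form a closed first-order system, so that a
  bound for one improves the bound for the other. For the denominator, \<open>sine\<close> is the
  companion of \<open>denom\<close> in the same sense.\<close>

definition lead :: "real \<Rightarrow> real \<Rightarrow> real" where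
  "lead s t = (g s - g (s + t)) \<bullet> T (s + t)"

definition denom :: "real \<Rightarrow> real \<Rightarrow> real" where
  "denom s t = 1 + T s \<bullet> T (s + t)"

definition sine :: "real \<Rightarrow> real \<Rightarrow> real" where
  "sine s t = T s \<bullet> n (s + t)"

text \<open>In the application this is the displacement in Lazutkin's parameter, the integral of
  \<open>k powr (2/3)\<close>, before normalisation.\<close>

definition disp :: "real \<Rightarrow> real \<Rightarrow> real" where
  "disp s t = W (s + t) - W s"

lemma gap_der: "(gap s has_real_derivative - k (s + t) * lead s t) (at t)"
proof -
  have "((\<lambda>t. g s - g (s + t)) has_vector_derivative 0 - T (s + t)) (at t)"
    by (intro derivative_intros has_vector_derivative_shift g_der)
  from has_real_derivative_inner[OF this has_vector_derivative_shift[OF n_der, of s t]]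
  show ?thesis unfolding gap_def[abs_def] lead_def using T_n[of "s + t"] by simp
qed

lemma lead_der: "(lead s has_real_derivative k (s + t) * gap s t - 1) (at t)"
proof -
  have "((\<lambda>t. g s - g (s + t)) has_vector_derivative 0 - T (s + t)) (at t)"
    by (intro derivative_intros has_vector_derivative_shift g_der)
  from has_real_derivative_inner[OF this has_vector_derivative_shift[OF T_der, of s t]]
  show ?thesis unfolding lead_def[abs_def] gap_def using T_T[of "s + t"] by simp
qed

lemma denom_der: "(denom s has_real_derivative k (s + t) * sine s t) (at t)"
proof -
  have "((\<lambda>t. T s) has_vector_derivative 0) (at t)" by simp
  from has_real_derivative_inner[OF this has_vector_derivative_shift[OF T_der, of s t]]
  show ?thesis unfolding denom_def[abs_def] sine_def
    by (auto intro!: derivative_eq_intros)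
qed

lemma sine_der: "(sine s has_real_derivative - k (s + t) * (denom s t - 1)) (at t)"
proof -
  have "((\<lambda>t. T s) has_vector_derivative 0) (at t)" by simp
  from has_real_derivative_inner[OF this has_vector_derivative_shift[OF n_der, of s t]]
  show ?thesis unfolding denom_def sine_def[abs_def] by simp
qed

text \<open>Anchor of the bootstrap: unit speed bounds the chord by \<open>\<bar>t\<bar>\<close>,
  and projecting to a unit normal cannot enlarge it.\<close>

lemma gap_bigo_1: "unif_bigo 1 gap"
proof (rule unif_bigoI[where C = 1])
  fix s t :: real
  have "norm (g (s + t) - g s) \<le> norm (t - 0) * 1"
  proof -
    have "norm (g (s + t) - g (s + 0)) \<le> 1 * norm (t - 0)"
    proof (rule differentiable_bound[where S = UNIV and f' = "\<lambda>x h. h *\<^sub>R T (s + x)"])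
      fix x :: real
      show "((\<lambda>t. g (s + t)) has_derivative (\<lambda>h. h *\<^sub>R T (s + x))) (at x within UNIV)"
        using has_vector_derivative_shift[OF g_der, of s x] by (simp add: has_vector_derivative_def)
      have "norm (T (s + x)) = 1" using T_T by (simp add: norm_eq_sqrt_inner)
      then show "onorm (\<lambda>h. h *\<^sub>R T (s + x)) \<le> 1"
        by (intro onorm_le) auto
    qed auto
    then show ?thesis by simp
  qed
  moreover have "norm (n (s + t)) = 1" using n_n by (simp add: norm_eq_sqrt_inner)
  ultimately show "\<bar>gap s t\<bar> \<le> 1 * \<bar>t\<bar> ^ 1"
    using Cauchy_Schwarz_ineq2[of "g s - g (s + t)" "n (s + t)"]
    unfolding gap_def by (simp add: norm_minus_commute)
qed

lemma k_shift: "unif_bigo 0 (\<lambda>s t. k (s + t))"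
  by (rule unif_bigo_shift[OF k_bd])

lemma k_diff: "unif_bigo 1 (\<lambda>s t. k (s + t) - k s)"
proof -
  have "unif_bigo (Suc 0) (\<lambda>s t. k (s + t) - k s)"
    by (rule unif_bigo_integrate[where F' = "\<lambda>s t. k1 (s + t)"])
      (auto intro!: derivative_eq_intros has_real_derivative_shift[OF k_der] unif_bigo_shift k1_bd)
  then show ?thesis by simp
qed

lemma gap_0 [simp]: "gap s 0 = 0" and lead_0 [simp]: "lead s 0 = 0"
  and sine_0 [simp]: "sine s 0 = 0" and denom_0 [simp]: "denom s 0 = 2"
  and disp_0 [simp]: "disp s 0 = 0"
  using T_T[of s] T_n[of s] by (simp_all add: gap_def lead_def sine_def denom_def disp_def)

lemma lead_bigo: "unif_bigo 2 (\<lambda>s t. lead s t + t)"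
proof -
  have "unif_bigo (0 + 1) (\<lambda>s t. k (s + t) * gap s t)"
    by (rule unif_bigo_mult[OF k_shift gap_bigo_1])
  then have "unif_bigo (Suc 1) (\<lambda>s t. lead s t + t)"
    by (intro unif_bigo_integrate[where F' = "\<lambda>s t. k (s + t) * gap s t"])
      (auto intro!: derivative_eq_intros lead_der)
  then show ?thesis by (simp add: numeral_2_eq_2)
qed

lemma gap_bigo_3: "unif_bigo 3 (\<lambda>s t. gap s t - k s / 2 * t\<^sup>2)"
proof -
  \<comment> \<open>This is the derivative of the difference in the claim, regrouped so that
    \<open>lead\<close> appears with its leading term \<open>- t\<close> removed and
    \<open>k (s + t)\<close> with \<open>k s\<close> removed. The later expansions repeat this
    pattern.\<close>
  have "unif_bigo 2 (\<lambda>s t. - (k (s + t) * (lead s t + t)) + (k (s + t) - k s) * t ^ 1)"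
    by (intro unif_bigo_add unif_bigo_minus unif_bigo_multI[OF k_shift lead_bigo]
        unif_bigo_multI[OF k_diff unif_bigo_power[of 1]]) simp_all
  then have "unif_bigo (Suc 2) (\<lambda>s t. gap s t - k s / 2 * t\<^sup>2)"
    by (rule unif_bigo_integrate[rotated 2])
      (auto intro!: derivative_eq_intros gap_der simp: algebra_simps)
  then show ?thesis by simp
qed

lemma lead_bigo_4: "unif_bigo 4 (\<lambda>s t. lead s t + t - (k s)\<^sup>2 / 6 * t ^ 3)"
proof -
  have "unif_bigo 3 (\<lambda>s t. k (s + t) * (gap s t - k s / 2 * t\<^sup>2) + (k (s + t) - k s) * (k s / 2 * t\<^sup>2))"
    by (intro unif_bigo_add unif_bigo_multI[OF k_shift gap_bigo_3]
        unif_bigo_multI[OF k_diff unif_bigo_term[OF bounded_fun_divide_const[OF k_bd]]])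
      simp_all
  then have "unif_bigo (Suc 3) (\<lambda>s t. lead s t + t - (k s)\<^sup>2 / 6 * t ^ 3)"
    by (rule unif_bigo_integrate[rotated 2])
      (auto intro!: derivative_eq_intros lead_der simp: field_simps power2_eq_square)
  then show ?thesis by simp
qed

text \<open>The coefficients arise by integrating \<open>- k (s + t) * lead s t\<close>: the Taylor
  polynomial of \<open>k\<close> times \<open>t\<close> yields the terms in \<open>k\<close>,
  \<open>k1\<close> and \<open>k2\<close>, and the cubic term of \<open>lead\<close> yields
  \<open>- k s ^ 3 / 24\<close>.\<close>

lemma gap_bigo_5:
  "unif_bigo 5 (\<lambda>s t. gap s t - (k s / 2 * t\<^sup>2 + k1 s / 3 * t ^ 3 + (k2 s / 8 - k s ^ 3 / 24) * t ^ 4))"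
proof -
  have "unif_bigo 4 (\<lambda>s t. - (k (s + t) * (lead s t + t - (k s)\<^sup>2 / 6 * t ^ 3))
      + t ^ 1 * (k (s + t) - (k s + k1 s * t + k2 s / 2 * t\<^sup>2))
      - (k (s + t) - k s) * ((k s)\<^sup>2 / 6 * t ^ 3))"
    by (intro unif_bigo_add unif_bigo_diff[of _ "\<lambda>s t. _ s t + _ s t"] unif_bigo_minus
        unif_bigo_multI[OF k_shift lead_bigo_4]
        unif_bigo_multI[OF unif_bigo_power[of 1] unif_bigo_taylor3[OF k_der k1_der k2_der k3_bd]]
        unif_bigo_multI[OF k_diff unif_bigo_term[OF bounded_fun_divide_const[OF bounded_fun_power[OF k_bd]]]])
      simp_all
  then have "unif_bigo (Suc 4) (\<lambda>s t. gap s t -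
      (k s / 2 * t\<^sup>2 + k1 s / 3 * t ^ 3 + (k2 s / 8 - k s ^ 3 / 24) * t ^ 4))"
    by (rule unif_bigo_integrate[rotated 2])
      (auto intro!: derivative_eq_intros gap_der
        simp: field_simps power2_eq_square power3_eq_cube)
  then show ?thesis by simp
qed

lemma sine_bigo: "unif_bigo 0 sine"
proof (rule unif_bigoI[where C = 1])
  fix s t :: real
  have "norm (T s) = 1" "norm (n (s + t)) = 1" using T_T n_n by (simp_all add: norm_eq_sqrt_inner)
  then show "\<bar>sine s t\<bar> \<le> 1 * \<bar>t\<bar> ^ 0"
    using Cauchy_Schwarz_ineq2[of "T s" "n (s + t)"] unfolding sine_def by simp
qed

text \<open>Third order suffices, since the error will be multiplied by \<open>quartic\<close>,
  which is itself of second order.\<close>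

lemma denom_bigo_3: "unif_bigo 3 (\<lambda>s t. denom s t - (2 - (k s)\<^sup>2 / 2 * t\<^sup>2))"
proof -
  have "unif_bigo (0 + 0) (\<lambda>s t. k (s + t) * sine s t)"
    by (rule unif_bigo_mult[OF k_shift sine_bigo])
  then have "unif_bigo (Suc 0) (\<lambda>s t. denom s t - 2)"
    by (intro unif_bigo_integrate[where F' = "\<lambda>s t. k (s + t) * sine s t"])
      (auto intro!: derivative_eq_intros denom_der)
  then have "unif_bigo 1 (\<lambda>s t. - (k (s + t) * (denom s t - 2)) - (k (s + t) - k s))"
    by (intro unif_bigo_diff[OF unif_bigo_minus k_diff] unif_bigo_multI[OF k_shift]) simp_all
  then have "unif_bigo (Suc 1) (\<lambda>s t. sine s t + k s * t)"
    by (rule unif_bigo_integrate[rotated 2])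
      (auto intro!: derivative_eq_intros sine_der simp: algebra_simps)
  then have "unif_bigo 2 (\<lambda>s t. sine s t + k s * t)" by (simp add: numeral_2_eq_2)
  then have "unif_bigo 2 (\<lambda>s t. k (s + t) * (sine s t + k s * t) - (k (s + t) - k s) * (k s * t ^ 1))"
    by (intro unif_bigo_diff unif_bigo_multI[OF k_shift]
        unif_bigo_multI[OF k_diff unif_bigo_term[OF k_bd]]) simp_all
  then have "unif_bigo (Suc 2) (\<lambda>s t. denom s t - (2 - (k s)\<^sup>2 / 2 * t\<^sup>2))"
    by (rule unif_bigo_integrate[rotated 2])
      (auto intro!: derivative_eq_intros denom_der simp: algebra_simps power2_eq_square)
  then show ?thesis by simp
qed

section \<open>Powers of the displacement and the approximating quartic\<close>

lemma disp_der: "(disp s has_real_derivative w (s + t)) (at t)"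
  unfolding disp_def[abs_def]
  using DERIV_diff[OF has_real_derivative_shift[OF W_der] DERIV_const[of "W s"], of s t] by simp

lemma disp_bigo_4:
  "unif_bigo 4 (\<lambda>s t. disp s t - (w s * t + w1 s / 2 * t\<^sup>2 + w2 s / 6 * t ^ 3))"
proof -
  have "unif_bigo (Suc 3) (\<lambda>s t. disp s t - (w s * t + w1 s / 2 * t\<^sup>2 + w2 s / 6 * t ^ 3))"
    by (rule unif_bigo_integrate[OF _ _ unif_bigo_taylor3[OF w_der w1_der w2_der w3_bd]])
      (auto intro!: derivative_eq_intros disp_der simp: algebra_simps)
  then show ?thesis by simp
qed

definition coeff2 :: "real \<Rightarrow> real" where
  "coeff2 s = k s / (4 * (w s)\<^sup>2)"

text \<open>With \<open>coeff2\<close> this gives the \<open>B\<close> and the \<open>A\<close> of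
  the expansion. They solve the equations obtained by comparing the terms in \<open>t^2\<close> and
  \<open>t^4\<close> of \<open>gap\<close> with those of \<open>denom * quartic\<close>; the
  \<open>t^3\<close> terms leave no unknown and are a condition on \<open>w\<close>.\<close>

definition coeff4 :: "real \<Rightarrow> real" where
  "coeff4 s = (k2 s / 8 - k s ^ 3 / 24 - 2 * coeff2 s * ((w1 s)\<^sup>2 / 4 + w s * w2 s / 3)
     + coeff2 s * (w s)\<^sup>2 * (k s)\<^sup>2 / 2) / (2 * w s ^ 4)"

lemma w_pos: "0 < w s" using wmin(1) wmin(2)[of s] by linarith

lemma k_pos: "0 < k s" using kmin(1) kmin(2)[of s] by linarith

lemma coeff2_bd: "bounded_fun coeff2"
proof -
  have "4 * wmin\<^sup>2 \<le> 4 * (w s)\<^sup>2" for s using wmin(1) wmin(2)[of s] by (simp add: power_mono)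
  then show ?thesis unfolding coeff2_def[abs_def] using wmin(1)
    by (intro bounded_fun_divide[where c = "4 * wmin\<^sup>2"] k_bd) auto
qed

lemma coeff4_bd: "bounded_fun coeff4"
proof -
  have "2 * wmin ^ 4 \<le> 2 * w s ^ 4" for s using wmin(1) wmin(2)[of s] by (simp add: power_mono)
  moreover have "bounded_fun (\<lambda>s. k2 s / 8 - k s ^ 3 / 24
      - 2 * coeff2 s * ((w1 s)\<^sup>2 / 4 + w s * w2 s / 3) + coeff2 s * (w s)\<^sup>2 * (k s)\<^sup>2 / 2)"
    unfolding power2_eq_square
    by (intro bounded_fun_add bounded_fun_diff bounded_fun_divide_const bounded_fun_mult
        bounded_fun_power bounded_fun_const k_bd k2_bd w_bd w1_bd w2_bd coeff2_bd)
  ultimately show ?thesis unfolding coeff4_def[abs_def] using wmin(1)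
    by (intro bounded_fun_divide[where c = "2 * wmin ^ 4"]) auto
qed

text \<open>Supplies the \<open>a\<close> of \<open>quartic_separation\<close>, uniformly in the
  base point.\<close>

lemma coeff2_lower: "\<exists>a>0. \<forall>s. a \<le> coeff2 s"
proof -
  obtain C where C: "\<And>s. \<bar>w s\<bar> \<le> C" using w_bd unfolding bounded_fun_def by blast
  have "kmin / (4 * C\<^sup>2) \<le> coeff2 s" for s
  proof -
    have "(w s)\<^sup>2 \<le> C\<^sup>2" using C[of s] w_pos[of s] by (intro power_mono) auto
    then show ?thesis unfolding coeff2_def using kmin(1) kmin(2)[of s] w_pos[of s]
      by (intro frac_le) auto
  qed
  moreover have "0 < C" using C[of 0] w_pos[of 0] by linarith
  then have "0 < kmin / (4 * C\<^sup>2)" using kmin(1) by simp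
  ultimately show ?thesis by blast
qed

lemma disp_bigo_2: "unif_bigo 2 (\<lambda>s t. disp s t - w s * t)"
proof -
  have "unif_bigo 2 (\<lambda>s t. (disp s t - (w s * t + w1 s / 2 * t\<^sup>2 + w2 s / 6 * t ^ 3))
      + (w1 s / 2 * t\<^sup>2 + w2 s / 6 * t ^ 3))"
    by (intro unif_bigo_add unif_bigo_mono[OF disp_bigo_4] unif_bigo_term bounded_fun_divide_const
        w1_bd w2_bd) auto
  then show ?thesis by (simp add: algebra_simps)
qed

lemma disp_bigo_1: "unif_bigo 1 disp"
proof -
  have "unif_bigo 1 (\<lambda>s t. (disp s t - w s * t) + w s * t ^ 1)"
    by (intro unif_bigo_add unif_bigo_mono[OF disp_bigo_2] unif_bigo_term w_bd) auto
  then show ?thesis by simp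
qed

lemma disp_sq_bigo_3: "unif_bigo 3 (\<lambda>s t. (disp s t)\<^sup>2 - (w s)\<^sup>2 * t\<^sup>2)"
proof -
  have "unif_bigo 3 (\<lambda>s t. (disp s t - w s * t) * (disp s t + w s * t ^ 1))"
    by (rule unif_bigo_multI[OF disp_bigo_2 unif_bigo_add[OF disp_bigo_1 unif_bigo_term[OF w_bd]]]) auto
  then show ?thesis by (simp add: algebra_simps power2_eq_square)
qed

lemma disp_sq_bigo_2: "unif_bigo 2 (\<lambda>s t. (disp s t)\<^sup>2)"
  unfolding power2_eq_square by (rule unif_bigo_multI[OF disp_bigo_1 disp_bigo_1]) simp

lemma disp_sq_bigo_5:
  "unif_bigo 5 (\<lambda>s t. (disp s t)\<^sup>2
     - ((w s)\<^sup>2 * t\<^sup>2 + w s * w1 s * t ^ 3 + ((w1 s)\<^sup>2 / 4 + w s * w2 s / 3) * t ^ 4))"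
proof -
  \<comment> \<open>With \<open>p\<close> the cubic Taylor polynomial of \<open>disp\<close>, this
    is \<open>(disp - p) * (disp + p)\<close>, where the second factor contributes the fifth order.
    The two added monomials are the part of \<open>p^2\<close> beyond degree four.\<close>
  have "unif_bigo 5 (\<lambda>s t.
      (disp s t - (w s * t + w1 s / 2 * t\<^sup>2 + w2 s / 6 * t ^ 3)) *
      (disp s t + (w s * t ^ 1 + w1 s / 2 * t\<^sup>2 + w2 s / 6 * t ^ 3))
      + w1 s * w2 s / 6 * t ^ 5 + (w2 s)\<^sup>2 / 36 * t ^ 6)"
    by (intro unif_bigo_add[of 5] unif_bigo_multI[OF disp_bigo_4, of 1] unif_bigo_add[of 1]
        disp_bigo_1 unif_bigo_term bounded_fun_divide_const bounded_fun_mult bounded_fun_power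
        w_bd w1_bd w2_bd) auto
  moreover have "(d - (w s * t + w1 s / 2 * t\<^sup>2 + w2 s / 6 * t ^ 3)) *
      (d + (w s * t ^ 1 + w1 s / 2 * t\<^sup>2 + w2 s / 6 * t ^ 3))
      + w1 s * w2 s / 6 * t ^ 5 + (w2 s)\<^sup>2 / 36 * t ^ 6 = d\<^sup>2
     - ((w s)\<^sup>2 * t\<^sup>2 + w s * w1 s * t ^ 3 + ((w1 s)\<^sup>2 / 4 + w s * w2 s / 3) * t ^ 4)" for d s t
    by (simp add: field_simps power2_eq_square power3_eq_cube power4_eq_xxxx eval_nat_numeral)
  ultimately show ?thesis by simp
qed

lemma disp_pow4_bigo_5: "unif_bigo 5 (\<lambda>s t. disp s t ^ 4 - w s ^ 4 * t ^ 4)"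
proof -
  have "unif_bigo 5 (\<lambda>s t. ((disp s t)\<^sup>2 - (w s)\<^sup>2 * t\<^sup>2) * ((disp s t)\<^sup>2 + (w s)\<^sup>2 * t\<^sup>2))"
    by (intro unif_bigo_multI[OF disp_sq_bigo_3, of 2] unif_bigo_add disp_sq_bigo_2 unif_bigo_term
        bounded_fun_power w_bd) auto
  then show ?thesis by (simp add: algebra_simps power2_eq_square power4_eq_xxxx)
qed

definition quartic :: "real \<Rightarrow> real \<Rightarrow> real" where
  "quartic s t = coeff2 s * (disp s t)\<^sup>2 + coeff4 s * disp s t ^ 4"

lemma quartic_bigo_5:
  "unif_bigo 5 (\<lambda>s t. quartic s t
     - (coeff2 s * ((w s)\<^sup>2 * t\<^sup>2 + w s * w1 s * t ^ 3 + ((w1 s)\<^sup>2 / 4 + w s * w2 s / 3) * t ^ 4)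
        + coeff4 s * (w s ^ 4 * t ^ 4)))"
proof -
  have "unif_bigo 5 (\<lambda>s t. coeff2 s * ((disp s t)\<^sup>2
     - ((w s)\<^sup>2 * t\<^sup>2 + w s * w1 s * t ^ 3 + ((w1 s)\<^sup>2 / 4 + w s * w2 s / 3) * t ^ 4))
     + coeff4 s * (disp s t ^ 4 - w s ^ 4 * t ^ 4))"
    by (intro unif_bigo_add unif_bigo_multI[OF unif_bigo_const disp_sq_bigo_5]
        unif_bigo_multI[OF unif_bigo_const disp_pow4_bigo_5] coeff2_bd coeff4_bd) auto
  then show ?thesis unfolding quartic_def by (simp add: algebra_simps)
qed

lemma quartic_bigo_3: "unif_bigo 3 (\<lambda>s t. quartic s t - coeff2 s * (w s)\<^sup>2 * t\<^sup>2)"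
proof -
  have "unif_bigo 4 (\<lambda>s t. (disp s t)\<^sup>2 * (disp s t)\<^sup>2)"
    by (rule unif_bigo_multI[OF disp_sq_bigo_2 disp_sq_bigo_2]) simp
  moreover have "x\<^sup>2 * x\<^sup>2 = x ^ 4" for x :: real by (simp flip: power_add)
  ultimately have "unif_bigo 4 (\<lambda>s t. disp s t ^ 4)" by simp
  then have "unif_bigo 3 (\<lambda>s t. disp s t ^ 4)" by (rule unif_bigo_mono) simp
  then have "unif_bigo 3 (\<lambda>s t. coeff2 s * ((disp s t)\<^sup>2 - (w s)\<^sup>2 * t\<^sup>2) + coeff4 s * disp s t ^ 4)"
    by (intro unif_bigo_add unif_bigo_multI[OF unif_bigo_const disp_sq_bigo_3]
        unif_bigo_multI[OF unif_bigo_const] coeff2_bd coeff4_bd) auto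
  then show ?thesis unfolding quartic_def by (simp add: algebra_simps)
qed

lemma quartic_bigo_2: "unif_bigo 2 quartic"
proof -
  have "unif_bigo 2 (\<lambda>s t. (quartic s t - coeff2 s * (w s)\<^sup>2 * t\<^sup>2) + coeff2 s * (w s)\<^sup>2 * t\<^sup>2)"
    by (intro unif_bigo_add unif_bigo_mono[OF quartic_bigo_3] unif_bigo_term bounded_fun_mult
        bounded_fun_power coeff2_bd w_bd) auto
  then show ?thesis by simp
qed

text \<open>
  The exponent \<open>2/3\<close> makes the cubic terms agree, so that in terms of \<open>disp\<close> the
  radius is even up to fifth order.
\<close>

lemma gap_eq_denom_quartic: "unif_bigo 5 (\<lambda>s t. gap s t - denom s t * quartic s t)"
proof -
  let ?F = "\<lambda>s t. k s / 2 * t\<^sup>2 + k1 s / 3 * t ^ 3 + (k2 s / 8 - k s ^ 3 / 24) * t ^ 4"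
  let ?Q = "\<lambda>s t. coeff2 s * ((w s)\<^sup>2 * t\<^sup>2 + w s * w1 s * t ^ 3 + ((w1 s)\<^sup>2 / 4 + w s * w2 s / 3) * t ^ 4)
        + coeff4 s * (w s ^ 4 * t ^ 4)"
  have coeffs: "?F s t = 2 * ?Q s t - (k s)\<^sup>2 / 2 * t\<^sup>2 * (coeff2 s * (w s)\<^sup>2 * t\<^sup>2)" for s t
  proof -
    have c2: "coeff2 s * (w s)\<^sup>2 = k s / 4" using w_pos[of s] by (simp add: coeff2_def)
    \<comment> \<open>Here the exponent enters: it turns the cubic coefficient of
      \<open>2 * ?Q\<close> into \<open>k1 s / 3\<close>, the one of \<open>gap\<close>.\<close>
    have "w1 s * k s = 2 / 3 * w s * k1 s" using w1_k[of s] by simp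
    then have c3: "coeff2 s * (w s * w1 s) = k1 s / 6"
      using w_pos[of s] by (simp add: coeff2_def field_simps power2_eq_square)
    have c4: "2 * coeff4 s * w s ^ 4 = k2 s / 8 - k s ^ 3 / 24
        - 2 * coeff2 s * ((w1 s)\<^sup>2 / 4 + w s * w2 s / 3) + coeff2 s * (w s)\<^sup>2 * (k s)\<^sup>2 / 2"
      using w_pos[of s] by (simp add: coeff4_def)
    have "2 * ?Q s t = 2 * (coeff2 s * (w s)\<^sup>2) * t\<^sup>2 + 2 * (coeff2 s * (w s * w1 s)) * t ^ 3
        + (2 * coeff2 s * ((w1 s)\<^sup>2 / 4 + w s * w2 s / 3) + 2 * coeff4 s * w s ^ 4) * t ^ 4"
      by (simp add: algebra_simps)
    also have "\<dots> = ?F s t + (coeff2 s * (w s)\<^sup>2 * (k s)\<^sup>2 / 2) * t ^ 4"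
      unfolding c3 c4 by (simp add: c2 algebra_simps)
    finally show ?thesis by (simp add: algebra_simps power2_eq_square power4_eq_xxxx)
  qed
  \<comment> \<open>A telescoping sum: each of \<open>gap\<close>, \<open>denom\<close> and
    \<open>quartic\<close> is replaced by its polynomial, and the polynomials left over cancel by
    \<open>coeffs\<close>. In the two products the orders \<open>3 + 2\<close> and
    \<open>2 + 3\<close> add up to five.\<close>
  have "unif_bigo 5 (\<lambda>s t. (gap s t - ?F s t)
      - (denom s t - (2 - (k s)\<^sup>2 / 2 * t\<^sup>2)) * quartic s t
      - 2 * (quartic s t - ?Q s t)
      + ((k s)\<^sup>2 / 2 * t\<^sup>2) * (quartic s t - coeff2 s * (w s)\<^sup>2 * t\<^sup>2))"
    by (rule unif_bigo_add[OF unif_bigo_diff[OF unif_bigo_diff[OF gap_bigo_5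
      unif_bigo_multI[OF denom_bigo_3 quartic_bigo_2]]
      unif_bigo_multI[OF unif_bigo_const quartic_bigo_5]]
      unif_bigo_multI[OF unif_bigo_term[OF bounded_fun_divide_const[OF bounded_fun_power[OF k_bd]]]
        quartic_bigo_3]]) auto
  then show ?thesis unfolding coeffs by (simp add: algebra_simps)
qed

section \<open>Offsets with equal radius\<close>

lemma disp_lower:
  assumes "0 < t"
  shows "wmin * t \<le> disp s t" "wmin * t \<le> - disp s (- t)"
proof -
  have inc: "wmin * (b - a) \<le> W b - W a" if ab: "a < b" for a b
  proof -
    obtain z where "W b - W a = (b - a) * w z" using MVT2[OF ab] W_der by metis
    then show ?thesis using wmin(2)[of z] ab by (simp add: mult.commute mult_left_mono)
  qed
  show "wmin * t \<le> disp s t" "wmin * t \<le> - disp s (- t)"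
    using inc[of s "s + t"] inc[of "s - t" s] assms by (auto simp: disp_def)
qed

definition radius :: "real \<Rightarrow> real \<Rightarrow> real" where
  "radius s t = gap s t / denom s t"

text \<open>The two-sided quadratic bound makes offsets of equal radius comparable; the last
  estimate carries the expansion from the numerator to the quotient.\<close>

lemma radius_local_bounds:
  obtains c K C \<tau> where "0 < c" "0 < K" "0 \<le> C" "0 < \<tau>" "\<tau> \<le> 1"
    "\<And>s t. \<bar>t\<bar> \<le> \<tau> \<Longrightarrow> c * t\<^sup>2 \<le> radius s t \<and> radius s t \<le> K * t\<^sup>2
       \<and> \<bar>radius s t - quartic s t\<bar> \<le> C * \<bar>t\<bar> ^ 5"
proof -
  have "unif_bigo 1 (\<lambda>s t. (denom s t - (2 - (k s)\<^sup>2 / 2 * t\<^sup>2)) - (k s)\<^sup>2 / 2 * t\<^sup>2)"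
    by (intro unif_bigo_diff[of 1] unif_bigo_mono[OF denom_bigo_3] unif_bigo_term
        bounded_fun_divide_const bounded_fun_power k_bd) auto
  then have "unif_bigo 1 (\<lambda>s t. denom s t - 2)" by simp
  then obtain D where D: "0 \<le> D" "\<And>s t. \<bar>t\<bar> \<le> 1 \<Longrightarrow> \<bar>denom s t - 2\<bar> \<le> D * \<bar>t\<bar> ^ 1"
    by (rule unif_bigoE) blast
  obtain G where G: "0 \<le> G" "\<And>s t. \<bar>t\<bar> \<le> 1 \<Longrightarrow> \<bar>gap s t - k s / 2 * t\<^sup>2\<bar> \<le> G * \<bar>t\<bar> ^ 3"
    using gap_bigo_3 by (rule unif_bigoE) blast
  obtain C where C: "0 \<le> C" "\<And>s t. \<bar>t\<bar> \<le> 1 \<Longrightarrow> \<bar>gap s t - denom s t * quartic s t\<bar> \<le> C * \<bar>t\<bar> ^ 5"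
    using gap_eq_denom_quartic by (rule unif_bigoE) blast
  obtain N where N: "\<And>s. \<bar>k s\<bar> \<le> N" using k_bd unfolding bounded_fun_def by blast
  have Npos: "0 < N" using N[of 0] k_pos[of 0] by linarith
  \<comment> \<open>The bound \<open>1 / (D + 1)\<close> keeps \<open>denom\<close> between
    \<open>1\<close> and \<open>3\<close>. The other one makes the cubic error of \<open>gap\<close>
    at most \<open>kmin / 4 * t^2\<close>, half of the least leading term; dividing by
    \<open>3\<close> gives the constant \<open>kmin / 12\<close>. The \<open>+ 1\<close> guards
    against zero divisors.\<close>
  define \<tau> where "\<tau> = min 1 (min (1 / (D + 1)) (kmin / (4 * (G + 1))))"
  show thesis
  proof
    show "0 < kmin / 12" "0 < N + G" "0 \<le> C" "0 < \<tau>" "\<tau> \<le> 1"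
      using kmin(1) Npos G(1) C(1) D(1) by (auto simp: \<tau>_def)
    fix s t :: real assume t: "\<bar>t\<bar> \<le> \<tau>"
    then have t1: "\<bar>t\<bar> \<le> 1" by (simp add: \<tau>_def)
    have "D * \<bar>t\<bar> \<le> 1"
    proof -
      have "\<bar>t\<bar> \<le> 1 / (D + 1)" using t by (simp add: \<tau>_def)
      then have "\<bar>t\<bar> * (D + 1) \<le> 1" using D(1) by (simp add: field_simps)
      then show ?thesis by (simp add: algebra_simps)
    qed
    then have den: "1 \<le> denom s t" "denom s t \<le> 3" using D(2)[OF t1, of s] by (auto simp: abs_le_iff)
    have Gt: "G * \<bar>t\<bar> \<le> kmin / 4"
    proof -
      have "\<bar>t\<bar> \<le> kmin / (4 * (G + 1))" using t by (simp add: \<tau>_def)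
      then have "\<bar>t\<bar> * (G + 1) \<le> kmin / 4" using G(1) by (simp add: field_simps)
      then show ?thesis by (simp add: algebra_simps)
    qed
    have "G * \<bar>t\<bar> ^ 3 = G * \<bar>t\<bar> * t\<^sup>2" by (simp add: power3_eq_cube power2_eq_square)
    also have "\<dots> \<le> kmin / 4 * t\<^sup>2" using Gt by (rule mult_right_mono) simp
    finally have G1: "G * \<bar>t\<bar> ^ 3 \<le> kmin / 4 * t\<^sup>2" .
    have k1: "kmin * t\<^sup>2 \<le> k s * t\<^sup>2" "k s * t\<^sup>2 \<le> N * t\<^sup>2"
      using kmin(2)[of s] N[of s] by (auto intro!: mult_right_mono)
    have gl: "kmin / 4 * t\<^sup>2 \<le> gap s t"
      using G(2)[OF t1, of s] G1 k1(1) by (simp add: abs_le_iff)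
    have gu: "gap s t \<le> N * t\<^sup>2"
      using G(2)[OF t1, of s] G1 k1 by (simp add: abs_le_iff)
    have "0 \<le> kmin / 4 * t\<^sup>2" using kmin(1) by simp
    then have gpos: "0 \<le> gap s t" using gl by linarith
    have "kmin / 12 * t\<^sup>2 \<le> gap s t / 3" using gl by simp
    also have "\<dots> \<le> gap s t / denom s t" using den gpos by (intro divide_left_mono) auto
    finally have 1: "kmin / 12 * t\<^sup>2 \<le> radius s t" by (simp add: radius_def)
    have "gap s t / denom s t \<le> gap s t / 1" using den gpos by (intro divide_left_mono) auto
    also have "\<dots> \<le> (N + G) * t\<^sup>2" using gu G(1) by (simp add: distrib_right add_increasing2)
    finally have 2: "radius s t \<le> (N + G) * t\<^sup>2" by (simp add: radius_def)
    have "radius s t - quartic s t = (gap s t - denom s t * quartic s t) / denom s t"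
      using den by (simp add: radius_def field_simps)
    then have "\<bar>radius s t - quartic s t\<bar> = \<bar>gap s t - denom s t * quartic s t\<bar> / denom s t"
      using den by simp
    also have "\<dots> \<le> \<bar>gap s t - denom s t * quartic s t\<bar> / 1"
      using den by (intro divide_left_mono) auto
    finally show "kmin / 12 * t\<^sup>2 \<le> radius s t \<and> radius s t \<le> (N + G) * t\<^sup>2
       \<and> \<bar>radius s t - quartic s t\<bar> \<le> C * \<bar>t\<bar> ^ 5"
      using 1 2 C(2)[OF t1, of s] by simp
  qed
qed

text \<open>No smallness of \<open>t\<^sub>2\<close> is assumed; it is deduced from monotonicity.
  That hypothesis reaches only up to \<open>t\<^sub>2\<close>, since the radius of the billiard
  increases only as far as the antipode.\<close>

lemma equal_radius_disp:
  obtains C \<delta> where "0 < \<delta>" "0 \<le> C"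
    "\<And>s t\<^sub>0 t\<^sub>2. 0 < t\<^sub>0 \<Longrightarrow> t\<^sub>0 < \<delta> \<Longrightarrow> 0 < t\<^sub>2 \<Longrightarrow> radius s t\<^sub>2 = radius s (- t\<^sub>0) \<Longrightarrow>
       (\<And>t. 0 < t \<Longrightarrow> t \<le> t\<^sub>2 \<Longrightarrow> radius s t \<le> radius s t\<^sub>2) \<Longrightarrow>
       \<bar>disp s t\<^sub>2 + disp s (- t\<^sub>0)\<bar> \<le> C * t\<^sub>0 ^ 4"
proof -
  obtain c K C5 \<tau>1 where c: "0 < c" "0 < K" "0 \<le> C5" "0 < \<tau>1" "\<tau>1 \<le> 1"
    and loc: "\<And>s t. \<bar>t\<bar> \<le> \<tau>1 \<Longrightarrow> c * t\<^sup>2 \<le> radius s t \<and> radius s t \<le> K * t\<^sup>2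
       \<and> \<bar>radius s t - quartic s t\<bar> \<le> C5 * \<bar>t\<bar> ^ 5"
    by (rule radius_local_bounds) blast
  obtain a where a: "0 < a" "\<And>s. a \<le> coeff2 s" using coeff2_lower by blast
  obtain b where b: "\<And>s. \<bar>coeff4 s\<bar> \<le> b" using coeff4_bd unfolding bounded_fun_def by blast
  have b0: "0 \<le> b" using b[of 0] by linarith
  obtain M where M: "0 \<le> M" "\<And>s t. \<bar>t\<bar> \<le> 1 \<Longrightarrow> \<bar>disp s t\<bar> \<le> M * \<bar>t\<bar> ^ 1"
    using disp_bigo_1 by (rule unif_bigoE) blast
  \<comment> \<open>Chosen so that \<open>c * t2^2 \<le> K * t0^2\<close> reads
    \<open>t2 \<le> \<kappa> * t0\<close>.\<close>
  define \<kappa> where "\<kappa> = sqrt (K / c)"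
  have \<kappa>: "0 < \<kappa>" "c * \<kappa>\<^sup>2 = K" using c by (auto simp: \<kappa>_def)
  \<comment> \<open>The second bound secures \<open>b * (X^2 + Y^2) \<le> a / 2\<close> as required
    by \<open>quartic_separation\<close>; the summand \<open>a\<close> keeps the divisor positive if
    \<open>b * M^2\<close> is zero.\<close>
  define \<tau> where "\<tau> = min \<tau>1 (a / (4 * (b * M\<^sup>2 + a)))"
  have den: "0 < 4 * (b * M\<^sup>2 + a)" using a(1) b0 by (simp add: add_nonneg_pos)
  have \<tau>: "0 < \<tau>" "\<tau> \<le> \<tau>1" "\<tau> \<le> 1" using c a(1) den by (auto simp: \<tau>_def)
  have \<tau>b: "b * (M\<^sup>2 * \<tau> + M\<^sup>2 * \<tau>) \<le> a / 2"
  proof -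
    have "\<tau> \<le> a / (4 * (b * M\<^sup>2 + a))" by (simp add: \<tau>_def)
    then have "\<tau> * (4 * (b * M\<^sup>2 + a)) \<le> a" using den by (simp add: pos_le_divide_eq)
    moreover have "0 \<le> \<tau> * a" using \<tau>(1) a(1) by simp
    ultimately show ?thesis by (simp add: algebra_simps)
  qed
  show thesis
  proof
    show "0 < min \<tau> (\<tau> / \<kappa>)" using \<tau> \<kappa> by simp
    show "0 \<le> 2 * (C5 / wmin * (\<kappa> ^ 4 + 1)) / a" using c a(1) wmin(1) \<kappa> by simp
    fix s t0 t2 :: real
    assume t0: "0 < t0" "t0 < min \<tau> (\<tau> / \<kappa>)" and t2: "0 < t2"
      and eq: "radius s t2 = radius s (- t0)"
      and mono: "\<And>t. 0 < t \<Longrightarrow> t \<le> t2 \<Longrightarrow> radius s t \<le> radius s t2"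
    have t0': "t0 < \<tau>" "\<kappa> * t0 < \<tau>" using t0 \<kappa> by (auto simp: field_simps)
    have up: "radius s (- t0) \<le> K * t0\<^sup>2" using loc[of "- t0" s] t0(1) t0'(1) \<tau>(2) by simp
    have sq: "c * x\<^sup>2 \<le> K * t0\<^sup>2 \<Longrightarrow> 0 \<le> x \<Longrightarrow> x \<le> \<kappa> * t0" for x
    proof -
      assume "c * x\<^sup>2 \<le> K * t0\<^sup>2" "0 \<le> x"
      moreover have "K * t0\<^sup>2 = c * (\<kappa> * t0)\<^sup>2"
        unfolding power_mult_distrib by (simp only: \<kappa>(2)[symmetric] mult.assoc)
      ultimately have "c * x\<^sup>2 \<le> c * (\<kappa> * t0)\<^sup>2" by linarith
      then have "x\<^sup>2 \<le> (\<kappa> * t0)\<^sup>2" using c(1) by (simp only: mult_le_cancel_left_pos)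
      then show "x \<le> \<kappa> * t0" 
        by (rule power2_le_imp_le) (rule less_imp_le[OF mult_pos_pos[OF \<kappa>(1) t0(1)]])
    qed
    \<comment> \<open>Were \<open>t2\<close> at least \<open>\<tau>\<close>, the radius at
      \<open>\<tau>\<close>, which is at least \<open>c * \<tau>^2\<close>, would not exceed
      \<open>K * t0^2\<close>; this contradicts \<open>\<kappa> * t0 < \<tau>\<close>.\<close>
    have t2\<tau>: "t2 < \<tau>"
    proof (rule ccontr)
      assume "\<not> t2 < \<tau>"
      then have "radius s \<tau> \<le> radius s t2" using mono[of \<tau>] \<tau>(1) by simp
      moreover have "c * \<tau>\<^sup>2 \<le> radius s \<tau>" using loc[of \<tau> s] \<tau> by simp
      ultimately have "\<tau> \<le> \<kappa> * t0" using up eq \<tau>(1) by (intro sq) auto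
      then show False using t0'(2) by linarith
    qed
    have t2k: "t2 \<le> \<kappa> * t0" using loc[of t2 s] t2 t2\<tau> \<tau>(2) up eq by (intro sq) auto
    \<comment> \<open>The backward displacement is negative, so both \<open>X\<close> and
      \<open>Y\<close> are positive lengths and opposite displacements mean
      \<open>X = Y\<close>.\<close>
    define X Y where "X = disp s t2" and "Y = - disp s (- t0)"
    have X: "wmin * t2 \<le> X" and Y: "wmin * t0 \<le> Y"
      using disp_lower[OF t2, of s] disp_lower[OF t0(1), of s] by (auto simp: X_def Y_def)
    have Xp: "0 < X" and Yp: "0 < Y"
      using X Y wmin(1) t2 t0(1) by (meson less_le_trans mult_pos_pos)+
    have small: "x\<^sup>2 \<le> M\<^sup>2 * \<tau>" if "\<bar>x\<bar> \<le> M * t" "0 \<le> t" "t \<le> \<tau>" for x t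
    proof -
      have "x\<^sup>2 \<le> (M * t)\<^sup>2" using power_mono[OF that(1), of 2] by simp
      also have "\<dots> = M\<^sup>2 * (t * t)" by (simp add: power2_eq_square)
      also have "\<dots> \<le> M\<^sup>2 * (\<tau> * 1)"
        using that \<tau> by (intro mult_left_mono mult_mono) auto
      finally show ?thesis by simp
    qed
    have "X\<^sup>2 \<le> M\<^sup>2 * \<tau>"
      using M(2)[of t2 s] t2 t2\<tau> \<tau>(3) by (intro small[of _ t2]) (auto simp: X_def)
    moreover have "Y\<^sup>2 \<le> M\<^sup>2 * \<tau>"
      using M(2)[of "- t0" s] t0(1) t0'(1) \<tau>(3) by (intro small[of _ t0]) (auto simp: Y_def)
    ultimately have "b * (X\<^sup>2 + Y\<^sup>2) \<le> b * (M\<^sup>2 * \<tau> + M\<^sup>2 * \<tau>)"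
      using b0 by (intro mult_left_mono add_mono)
    then have bXY: "b * (X\<^sup>2 + Y\<^sup>2) \<le> a / 2" using \<tau>b by linarith
    have "\<bar>quartic s t2 - quartic s (- t0)\<bar> \<le> C5 * t2 ^ 5 + C5 * t0 ^ 5"
      using loc[of t2 s] loc[of "- t0" s] t2 t2\<tau> t0(1) t0'(1) \<tau>(2) eq by auto
    moreover have "quartic s t2 = coeff2 s * X\<^sup>2 + coeff4 s * X ^ 4"
      "quartic s (- t0) = coeff2 s * Y\<^sup>2 + coeff4 s * Y ^ 4"
      by (simp_all add: quartic_def X_def Y_def)
    \<comment> \<open>One power of \<open>t2\<close> and of \<open>t0\<close> is traded for
      \<open>X / wmin\<close> and \<open>Y / wmin\<close>, which produces the factor
      \<open>X + Y\<close> to be cancelled; the remaining fourth powers are bounded through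
      \<open>t2 \<le> \<kappa> * t0\<close>.\<close>
    moreover have "C5 * t2 ^ 5 + C5 * t0 ^ 5 \<le> (C5 / wmin * (\<kappa> ^ 4 + 1) * t0 ^ 4) * (X + Y)"
    proof -
      have "t2 ^ 4 \<le> \<kappa> ^ 4 * t0 ^ 4"
        using power_mono[OF t2k, of 4] t2 by (simp add: power_mult_distrib)
      moreover have "t2 \<le> X / wmin" using X wmin(1) by (simp add: field_simps)
      ultimately have "t2 ^ 4 * t2 \<le> (\<kappa> ^ 4 * t0 ^ 4) * (X / wmin)"
        using t2 t0(1) \<kappa>(1) by (intro mult_mono) auto
      then have 1: "t2 ^ 5 \<le> (\<kappa> ^ 4 * t0 ^ 4) * (X / wmin)" by (simp add: eval_nat_numeral mult_ac)
      have "t0 \<le> Y / wmin" using Y wmin(1) by (simp add: field_simps)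
      then have "t0 ^ 4 * t0 \<le> t0 ^ 4 * (Y / wmin)" using t0(1) by (intro mult_left_mono) auto
      then have 2: "t0 ^ 5 \<le> t0 ^ 4 * (Y / wmin)" by (simp add: eval_nat_numeral mult_ac)
      have 3: "0 \<le> t0 ^ 4 * (X / wmin)" "0 \<le> (\<kappa> ^ 4 * t0 ^ 4) * (Y / wmin)"
        using Xp Yp t0(1) wmin(1) by auto
      have "t2 ^ 5 + t0 ^ 5 \<le> (\<kappa> ^ 4 * t0 ^ 4) * (X / wmin) + t0 ^ 4 * (Y / wmin)
          + (t0 ^ 4 * (X / wmin) + (\<kappa> ^ 4 * t0 ^ 4) * (Y / wmin))"
        using 1 2 3 by linarith
      also have "\<dots> = 1 / wmin * (\<kappa> ^ 4 + 1) * t0 ^ 4 * (X + Y)"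
        using wmin(1) by (simp add: field_simps)
      finally have "C5 * (t2 ^ 5 + t0 ^ 5) \<le> C5 * (1 / wmin * (\<kappa> ^ 4 + 1) * t0 ^ 4 * (X + Y))"
        using c(3) by (rule mult_left_mono)
      then show ?thesis by (simp add: algebra_simps)
    qed
    ultimately have "\<bar>X - Y\<bar> \<le> 2 * (C5 / wmin * (\<kappa> ^ 4 + 1) * t0 ^ 4) / a"
      by (intro quartic_separation[OF Xp Yp a(1) a(2)[of s] b[of s] bXY]) linarith
    then show "\<bar>disp s t2 + disp s (- t0)\<bar> \<le> 2 * (C5 / wmin * (\<kappa> ^ 4 + 1)) / a * t0 ^ 4"
      by (simp add: X_def Y_def)
  qed
qed

end

section \<open>Geometry of the boundary curve\<close>

lemma inner_real2: "v \<bullet> (u :: real^2) = v $ 1 * u $ 1 + v $ 2 * u $ 2"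
  by (simp add: inner_vec_def sum_2)

lemma rot90_nth [simp]: "rot90 v $ 1 = - v $ 2" "rot90 v $ 2 = v $ 1"
  by (simp_all add: rot90_def)

lemma rot90_rot90 [simp]: "rot90 (rot90 v) = - v"
  by (simp add: vec_eq_iff forall_2)

lemma rot90_minus [simp]: "rot90 (- v) = - rot90 v"
  by (simp add: vec_eq_iff forall_2)

lemma rot90_scaleR [simp]: "rot90 (c *\<^sub>R v) = c *\<^sub>R rot90 v"
  by (simp add: vec_eq_iff forall_2)

lemma inner_rot90_self [simp]: "v \<bullet> rot90 v = 0" "rot90 v \<bullet> v = 0"
  by (simp_all add: inner_real2)

lemma inner_rot90_rot90 [simp]: "rot90 u \<bullet> rot90 v = u \<bullet> v"
  by (simp add: inner_real2)

lemma inner_rot90_swap: "rot90 u \<bullet> v = - (u \<bullet> rot90 v)"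
  by (simp add: inner_real2)

lemma bounded_linear_rot90: "bounded_linear rot90"
  by (intro linear_conv_bounded_linear[THEN iffD1] linearI)
    (simp_all add: vec_eq_iff forall_2)

lemma rot90_expansion:
  fixes u v :: "real^2"
  assumes "u \<bullet> u = 1"
  shows "v = (v \<bullet> u) *\<^sub>R u + (v \<bullet> rot90 u) *\<^sub>R rot90 u"
proof -
  have u: "u $ 1 * u $ 1 + u $ 2 * u $ 2 = 1" using assms by (simp add: inner_real2)
  have "(v \<bullet> u) * u $ 1 + (v \<bullet> rot90 u) * rot90 u $ 1 = v $ 1 * (u $ 1 * u $ 1 + u $ 2 * u $ 2)"
    "(v \<bullet> u) * u $ 2 + (v \<bullet> rot90 u) * rot90 u $ 2 = v $ 2 * (u $ 1 * u $ 1 + u $ 2 * u $ 2)"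
    by (simp_all add: inner_real2 algebra_simps)
  then show ?thesis by (simp add: u vec_eq_iff forall_2)
qed

lemma rot90_pythagoras:
  fixes u v :: "real^2"
  assumes "u \<bullet> u = 1"
  shows "v \<bullet> v = (v \<bullet> u)\<^sup>2 + (v \<bullet> rot90 u)\<^sup>2"
  by (subst rot90_expansion[OF assms, of v])
    (simp add: inner_add_left inner_add_right assms power2_eq_square)

text \<open>The circle meets the line where \<open>(a - t)^2 + d^2 = r^2\<close>. The solutions are
  symmetric about the foot \<open>a\<close> of the perpendicular, so a single solution must be
  \<open>t = a\<close>, which means \<open>d^2 = r^2\<close>.\<close>

lemma tangent_to_circle_iff:
  fixes u p c :: "real^2"
  assumes u: "u \<bullet> u = 1" and r: "0 < r"
  shows "tangent_to_circle (range (\<lambda>t. p + t *\<^sub>R u)) c r \<longleftrightarrow> \<bar>(c - p) \<bullet> rot90 u\<bar> = r"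
proof -
  define a where "a = (c - p) \<bullet> u"
  define d where "d = (c - p) \<bullet> rot90 u"
  have sph: "p + t *\<^sub>R u \<in> sphere c r \<longleftrightarrow> (a - t)\<^sup>2 + d\<^sup>2 = r\<^sup>2" for t
  proof -
    have "p + t *\<^sub>R u \<in> sphere c r \<longleftrightarrow> norm (c - (p + t *\<^sub>R u)) = r" by (simp add: dist_norm)
    also have "\<dots> \<longleftrightarrow> (norm (c - (p + t *\<^sub>R u)))\<^sup>2 = r\<^sup>2" using r by (simp add: power2_eq_iff_nonneg)
    also have "(norm (c - (p + t *\<^sub>R u)))\<^sup>2
        = ((c - (p + t *\<^sub>R u)) \<bullet> u)\<^sup>2 + ((c - (p + t *\<^sub>R u)) \<bullet> rot90 u)\<^sup>2"
      unfolding power2_norm_eq_inner by (rule rot90_pythagoras[OF u])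
    also have "(c - (p + t *\<^sub>R u)) \<bullet> u = a - t"
      by (simp add: a_def inner_diff_left inner_add_left u)
    also have "(c - (p + t *\<^sub>R u)) \<bullet> rot90 u = d"
      by (simp add: d_def inner_diff_left inner_add_left)
    finally show ?thesis .
  qed
  show ?thesis
  proof
    assume "tangent_to_circle (range (\<lambda>t. p + t *\<^sub>R u)) c r"
    then obtain t where t: "p + t *\<^sub>R u \<in> sphere c r"
      and uniq: "\<And>q. q \<in> range (\<lambda>t. p + t *\<^sub>R u) \<inter> sphere c r \<Longrightarrow> q = p + t *\<^sub>R u"
      unfolding tangent_to_circle_def by blast
    have "p + (2 * a - t) *\<^sub>R u \<in> sphere c r"
      using t unfolding sph by (simp add: power2_eq_square algebra_simps)
    then have "p + (2 * a - t) *\<^sub>R u = p + t *\<^sub>R u" by (intro uniq) blast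
    then have "(2 * a - t) *\<^sub>R u = t *\<^sub>R u" by simp
    moreover have "u \<noteq> 0" using u by auto
    ultimately have "2 * a - t = t" by (simp only: scaleR_cancel_right) blast
    then have "d\<^sup>2 = r\<^sup>2" using t unfolding sph by simp
    then show "\<bar>(c - p) \<bullet> rot90 u\<bar> = r" using r unfolding d_def by (auto simp: power2_eq_iff)
  next
    assume "\<bar>(c - p) \<bullet> rot90 u\<bar> = r"
    then have d: "d\<^sup>2 = r\<^sup>2" unfolding d_def by (metis power2_abs)
    show "tangent_to_circle (range (\<lambda>t. p + t *\<^sub>R u)) c r" unfolding tangent_to_circle_def
    proof (rule ex1I[of _ "p + a *\<^sub>R u"])
      show "p + a *\<^sub>R u \<in> range (\<lambda>t. p + t *\<^sub>R u) \<inter> sphere c r" using sph[of a] d by auto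
      fix q assume "q \<in> range (\<lambda>t. p + t *\<^sub>R u) \<inter> sphere c r"
      then obtain t where "q = p + t *\<^sub>R u" "p + t *\<^sub>R u \<in> sphere c r" by auto
      then show "q = p + a *\<^sub>R u" unfolding sph using d by simp
    qed
  qed
qed

section \<open>Bounds for continuous periodic functions\<close>

lemma periodic_shift_int:
  fixes f :: "real \<Rightarrow> 'a"
  assumes per: "\<And>x. f (x + p) = f x"
  shows "f (x + of_int m * p) = f x"
proof -
  have nat: "f (x + real n * p) = f x" for x n
  proof (induction n)
    case (Suc n)
    have "f (x + real (Suc n) * p) = f ((x + real n * p) + p)" by (simp add: algebra_simps)
    then show ?case using Suc per by simp
  qed simp
  show ?thesis
  proof (cases "0 \<le> m")
    case True
    then show ?thesis using nat[of x "nat m"] by simp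
  next
    case False
    then show ?thesis using nat[of "x + of_int m * p" "nat (- m)"] by (simp add: algebra_simps)
  qed
qed

lemma periodic_range:
  fixes f :: "real \<Rightarrow> 'a"
  assumes per: "\<And>x. f (x + p) = f x" and p: "0 < p"
  shows "\<exists>y\<in>{0..p}. f x = f y"
proof -
  define m where "m = \<lfloor>x / p\<rfloor>"
  have "of_int m \<le> x / p" "x / p < of_int m + 1" by (auto simp: m_def)
  then have "x + of_int (- m) * p \<in> {0..p}" using p by (auto simp: field_simps)
  then show ?thesis using periodic_shift_int[of f p, OF per, of x "- m"] by metis
qed

lemma periodic_bounded_fun:
  assumes "\<And>x. f (x + p) = f x" "0 < p" "continuous_on UNIV f"
  shows "bounded_fun f"
proof -
  have "continuous_on {0..p} (\<lambda>x. \<bar>f x\<bar>)"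
    using assms(3) by (intro continuous_intros) (rule continuous_on_subset, auto)
  then obtain y where "\<forall>x\<in>{0..p}. \<bar>f x\<bar> \<le> \<bar>f y\<bar>"
    using continuous_attains_sup[of "{0..p}" "\<lambda>x. \<bar>f x\<bar>"] assms(2) by auto
  then have "\<bar>f x\<bar> \<le> \<bar>f y\<bar>" for x using periodic_range[of f p x, OF assms(1,2)] by auto
  then show ?thesis unfolding bounded_fun_def by blast
qed

lemma periodic_pos_lower_bound:
  fixes f :: "real \<Rightarrow> real"
  assumes "\<And>x. f (x + p) = f x" "0 < p" "continuous_on UNIV f" "\<And>x. 0 < f x"
  obtains c where "0 < c" "\<And>x. c \<le> f x"
proof -
  have "continuous_on {0..p} f" using assms(3) by (rule continuous_on_subset) auto
  then obtain y where "\<forall>x\<in>{0..p}. f y \<le> f x"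
    using continuous_attains_inf[of "{0..p}" f] assms(2) by auto
  then have "f y \<le> f x" for x using periodic_range[of f p x, OF assms(1,2)] by auto
  then show thesis using that[of "f y"] assms(4) by blast
qed

text \<open>
  The two signs distinguish the circles inside and outside the angle formed by the tangents;
  only the positive one admits a positive radius.
\<close>

lemma tangency_radius_iff:
  fixes h x r :: real
  assumes "0 < h" "0 < r" "-1 < x" "x \<le> 1"
  shows "\<bar>h - r * x\<bar> = r \<longleftrightarrow> r = h / (1 + x)"
proof -
  have "r * x \<le> r" using mult_left_mono[OF assms(4), of r] assms(2) by simp
  then have "\<bar>h - r * x\<bar> = r \<longleftrightarrow> h - r * x = r" using assms(1) by (auto simp: abs_if)
  also have "\<dots> \<longleftrightarrow> r = h / (1 + x)" using assms(3) by (auto simp: field_simps)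
  finally show ?thesis .
qed

section \<open>The boundary curve and its moving frame\<close>

locale convex_boundary =
  fixes \<Omega> :: "(real^2) set" and \<l> :: real and \<gamma> :: "real \<Rightarrow> real^2"
  assumes open_\<Omega>: "open \<Omega>" and nonempty: "\<Omega> \<noteq> {}"
    and strict: "strictly_convex \<Omega>"
    and boundary: "ccw_arclength_boundary \<Omega> \<l> \<gamma>"
    and curvature_pos: "\<forall>s. 0 < curvature \<gamma> s"
begin

abbreviation T :: "real \<Rightarrow> real^2" where "T \<equiv> unit_tangent \<gamma>"

abbreviation normal :: "real \<Rightarrow> real^2" where "normal s \<equiv> rot90 (T s)"

abbreviation k :: "real \<Rightarrow> real" where "k \<equiv> curvature \<gamma>"

lemma l_pos: "0 < \<l>"
  using boundary by (simp add: ccw_arclength_boundary_def)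

lemma jet_exists:
  obtains D where "D 0 = \<gamma>" "D 1 = T"
    "\<And>n s. (D n has_vector_derivative D (Suc n) s) (at s)"
proof -
  obtain D where D: "D 0 = \<gamma>" "\<And>n s. (D n has_vector_derivative D (Suc n) s) (at s)"
    using boundary unfolding ccw_arclength_boundary_def smooth_curve_def by metis
  have "D 1 s = T s" for s
    using D(2)[of 0 s] D(1) by (simp add: unit_tangent_def vector_derivative_at)
  then have "D 1 = T" by blast
  with D show thesis using that by blast
qed

lemma T_T: "T s \<bullet> T s = 1"
  using boundary by (simp add: ccw_arclength_boundary_def dot_square_norm)

lemma \<gamma>_der: "(\<gamma> has_vector_derivative T s) (at s)"
proof -
  obtain D where "D 0 = \<gamma>" "D 1 = T"
    "\<And>n s. (D n has_vector_derivative D (Suc n) s) (at s)" by (rule jet_exists) blast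
  then show ?thesis by (metis One_nat_def)
qed

lemma T_der: "(T has_vector_derivative k s *\<^sub>R normal s) (at s)"
proof -
  obtain D where D: "D 0 = \<gamma>" "D 1 = T"
    "\<And>n s. (D n has_vector_derivative D (Suc n) s) (at s)" by (rule jet_exists) blast
  have T': "(T has_vector_derivative D 2 s) (at s)"
    using D(3)[of 1 s] D(2) by (simp add: numeral_2_eq_2)
  then have k: "k s = D 2 s \<bullet> normal s" unfolding curvature_def by (simp add: vector_derivative_at)
  have "((\<lambda>t. T t \<bullet> T t) has_real_derivative (T s \<bullet> D 2 s + D 2 s \<bullet> T s)) (at s)"
    by (rule has_real_derivative_inner[OF T' T'])
  moreover have "((\<lambda>t. T t \<bullet> T t) has_real_derivative 0) (at s)" by (simp add: T_T)
  ultimately have "T s \<bullet> D 2 s + D 2 s \<bullet> T s = 0" by (rule DERIV_unique)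
  then have "D 2 s \<bullet> T s = 0" by (simp add: inner_commute)
  then have "D 2 s = k s *\<^sub>R normal s" using rot90_expansion[OF T_T, of "D 2 s" s] k by simp
  then show ?thesis using T' by simp
qed

lemma normal_der: "(normal has_vector_derivative - k s *\<^sub>R T s) (at s)"
  using bounded_linear.has_vector_derivative[OF bounded_linear_rot90 T_der] by simp

lemma continuous_\<gamma>: "continuous_on S \<gamma>" and continuous_T: "continuous_on S T"
  and continuous_normal: "continuous_on S normal"
  using \<gamma>_der T_der normal_der
  by (meson continuous_at_imp_continuous_on has_vector_derivative_continuous)+

lemma periodic: "\<gamma> (s + \<l>) = \<gamma> s"
  using boundary by (simp add: ccw_arclength_boundary_def)

lemma T_periodic: "T (s + \<l>) = T s"
proof -
  have "((\<lambda>t. \<gamma> (\<l> + t)) has_vector_derivative T (\<l> + s)) (at s)"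
    by (rule has_vector_derivative_shift[OF \<gamma>_der])
  then have "(\<gamma> has_vector_derivative T (s + \<l>)) (at s)"
    by (simp add: periodic add.commute[of \<l>])
  then show ?thesis using \<gamma>_der vector_derivative_unique_at by blast
qed

text \<open>A multiple of the period moves \<open>s\<close> into the interval where injectivity is
  given; if \<open>t\<close> then lies beyond its end, one further period brings it back below
  \<open>s\<close>.\<close>

lemma \<gamma>_neq:
  assumes "s < t" "t < s + \<l>"
  shows "\<gamma> t \<noteq> \<gamma> s"
proof
  assume eq: "\<gamma> t = \<gamma> s"
  have inj: "inj_on \<gamma> {0..<\<l>}" using boundary by (simp add: ccw_arclength_boundary_def)
  note shift = periodic_shift_int[of \<gamma> \<l>, OF periodic]
  define m where "m = \<lfloor>s / \<l>\<rfloor>"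
  define s' t' where "s' = s + of_int (- m) * \<l>" and "t' = t + of_int (- m) * \<l>"
  have e': "\<gamma> t' = \<gamma> s'" using eq shift by (simp only: s'_def t'_def)
  have "of_int m \<le> s / \<l>" "s / \<l> < of_int m + 1" by (auto simp: m_def)
  then have s': "0 \<le> s'" "s' < \<l>" using l_pos by (auto simp: s'_def field_simps)
  have t': "s' < t'" "t' < s' + \<l>" using assms by (auto simp: s'_def t'_def)
  show False
  proof (cases "t' < \<l>")
    case True
    then show ?thesis using inj_onD[OF inj e'] s' t' by auto
  next
    case False
    have "\<gamma> (t' - \<l>) = \<gamma> s'" using periodic[of "t' - \<l>"] e' by simp
    then show ?thesis using inj_onD[OF inj, of "t' - \<l>" s'] False s' t' by auto
  qed
qed

section \<open>Support lines\<close>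

lemma interior_\<Omega>: "x \<in> closure \<Omega> \<Longrightarrow> y \<in> closure \<Omega> \<Longrightarrow> open_segment x y \<subseteq> \<Omega>"
  using strict open_\<Omega> by (simp add: strictly_convex_def interior_open)

lemma \<gamma>_frontier: "\<gamma> s \<in> frontier \<Omega>"
  using boundary by (auto simp: ccw_arclength_boundary_def)

lemma \<gamma>_closure: "\<gamma> s \<in> closure \<Omega>"
  using \<gamma>_frontier by (auto simp: frontier_def)

lemma inward: "\<forall>\<^sub>F t in at_right 0. \<gamma> s + t *\<^sub>R normal s \<in> \<Omega>"
  using boundary by (auto simp: ccw_arclength_boundary_def)

lemma convex_\<Omega>: "convex \<Omega>"
  unfolding convex_contains_open_segment using interior_\<Omega> closure_subset by blast

text \<open>Separation yields some supporting functional \<open>a\<close> at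
  \<open>\<gamma> s\<close>. It is minimal along the curve at \<open>s\<close>, so it annihilates
  \<open>T s\<close> and is a multiple of the normal; the inward condition decides the sign.\<close>

lemma support_closure:
  assumes "z \<in> closure \<Omega>"
  shows "0 \<le> normal s \<bullet> (z - \<gamma> s)"
proof -
  have "\<gamma> s \<notin> \<Omega>" using \<gamma>_frontier[of s] open_\<Omega> by (simp add: frontier_def interior_open)
  then obtain a b where a: "a \<noteq> 0" "a \<bullet> \<gamma> s \<le> b" "\<forall>x\<in>\<Omega>. b \<le> a \<bullet> x"
    using separating_hyperplane_sets[of "{\<gamma> s}" \<Omega>] convex_\<Omega> nonempty by auto
  have "closure \<Omega> \<subseteq> {x. b \<le> a \<bullet> x}"
    using a(3) by (intro closure_minimal closed_Collect_le continuous_intros) auto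
  then have cl: "b \<le> a \<bullet> x" if "x \<in> closure \<Omega>" for x using that by blast
  have "((\<lambda>t. a \<bullet> \<gamma> t) has_real_derivative (a \<bullet> T s + 0 \<bullet> \<gamma> s)) (at s)"
    by (intro has_real_derivative_inner \<gamma>_der) simp
  moreover have "\<forall>t. \<bar>s - t\<bar> < 1 \<longrightarrow> a \<bullet> \<gamma> s \<le> a \<bullet> \<gamma> t"
    using a(2) cl[OF \<gamma>_closure] by (meson order_trans)
  ultimately have "a \<bullet> T s + 0 \<bullet> \<gamma> s = 0" by (rule DERIV_local_min[OF _ zero_less_one])
  then have aT: "a \<bullet> T s = 0" by simp
  define c where "c = a \<bullet> normal s"
  have ac: "a = c *\<^sub>R normal s" using rot90_expansion[OF T_T, of a s] aT by (simp add: c_def)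
  have "\<forall>\<^sub>F t in at_right (0::real). 0 < t \<and> \<gamma> s + t *\<^sub>R normal s \<in> \<Omega>"
    using inward[of s] eventually_at_right_less by (rule eventually_conj[rotated])
  then obtain t where t: "0 < t" "\<gamma> s + t *\<^sub>R normal s \<in> \<Omega>"
    using eventually_happens'[OF trivial_limit_at_right_real] by blast
  have "b \<le> a \<bullet> (\<gamma> s + t *\<^sub>R normal s)" using t(2) a(3) by blast
  then have "0 \<le> t * c" using a(2) by (simp add: inner_add_right c_def)
  then have "0 \<le> c" using t(1) by (simp add: zero_le_mult_iff)
  then have c: "0 < c" using a(1) ac by (cases "c = 0") auto
  have "0 \<le> a \<bullet> (z - \<gamma> s)" using a(2) cl[OF assms] by (simp add: inner_diff_right)
  then have "0 \<le> c * (normal s \<bullet> (z - \<gamma> s))" unfolding ac by simp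
  then show ?thesis using c by (simp add: zero_le_mult_iff)
qed

lemma support_interior:
  assumes "z \<in> \<Omega>"
  shows "0 < normal s \<bullet> (z - \<gamma> s)"
proof -
  obtain e where e: "0 < e" "ball z e \<subseteq> \<Omega>" using assms open_\<Omega> open_contains_ball by blast
  have nn: "norm (normal s) = 1" using T_T by (simp add: norm_eq_sqrt_inner)
  have "z - (e / 2) *\<^sub>R normal s \<in> ball z e" using e(1) nn by (simp add: dist_norm)
  then have "z - (e / 2) *\<^sub>R normal s \<in> closure \<Omega>" using e(2) closure_subset by blast
  from support_closure[OF this, of s]
  have "0 \<le> normal s \<bullet> (z - \<gamma> s) - e / 2"
    using T_T[of s] by (simp add: inner_diff_right algebra_simps)
  then show ?thesis using e(1) by linarith
qed

text \<open>By strict convexity the midpoint of the chord lies in \<open>\<Omega>\<close>, and its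
  height over the tangent is half that of \<open>\<gamma> t\<close>.\<close>

lemma support_strict:
  assumes "\<gamma> t \<noteq> \<gamma> s"
  shows "0 < normal s \<bullet> (\<gamma> t - \<gamma> s)"
proof -
  have "midpoint (\<gamma> s) (\<gamma> t) \<in> open_segment (\<gamma> s) (\<gamma> t)" using assms by simp
  then have "midpoint (\<gamma> s) (\<gamma> t) \<in> \<Omega>" using interior_\<Omega>[OF \<gamma>_closure \<gamma>_closure] by blast
  from support_interior[OF this, of s]
  have "0 < normal s \<bullet> ((1 / 2) *\<^sub>R (\<gamma> s + \<gamma> t) - \<gamma> s)" by (simp add: midpoint_def)
  also have "(1 / 2) *\<^sub>R (\<gamma> s + \<gamma> t) - \<gamma> s = (1 / 2) *\<^sub>R (\<gamma> t - \<gamma> s)"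
    by (simp add: vec_eq_iff field_simps)
  finally show ?thesis by simp
qed

section \<open>The antipodal parameter and the turning of the tangent\<close>

lemma parallel_opposite:
  assumes "s < t" "t < s + \<l>" and par: "T t = c *\<^sub>R T s"
  shows "T t = - T s"
proof -
  have "c * c = 1" using T_T[of t] T_T[of s] par by simp
  then have "c = 1 \<or> c = -1" by (simp add: square_eq_1_iff)
  \<comment> \<open>Equal tangents have equal normals, and then each of the two points would lie
    strictly higher than the other.\<close>
  moreover have "c \<noteq> 1"
  proof
    assume "c = 1"
    then have "0 < normal s \<bullet> (\<gamma> s - \<gamma> t)"
      using support_strict[of s t] \<gamma>_neq[OF assms(1,2)] par by simp
    moreover have "0 < normal s \<bullet> (\<gamma> t - \<gamma> s)" by (rule support_strict[OF \<gamma>_neq[OF assms(1,2)]])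
    ultimately show False by (simp add: inner_diff_right)
  qed
  ultimately show ?thesis using par by auto
qed

text \<open>Two parameters opposite to \<open>s\<close> have equal, hence parallel tangents; applied
  to this pair, \<open>parallel_opposite\<close> makes them opposite to each other, which is
  absurd.\<close>

lemma opposite_unique:
  assumes "s < t" "t < s + \<l>" "T t = - T s" "s < t'" "t' < s + \<l>" "T t' = - T s"
  shows "t = t'"
proof (rule ccontr)
  have no: False if "s < x" "x < y" "y < s + \<l>" "T x = - T s" "T y = - T s" for x y
  proof -
    have "T y = - T x" using that by (intro parallel_opposite[of x y 1]) auto
    then have "T s = - T s" using that by simp
    then show False using T_T[of s] by (metis inner_minus_left one_neq_neg_one)
  qed
  assume "t \<noteq> t'"
  then show False using no[of t t'] no[of t' t] assms by linarith
qed

abbreviation star :: "real \<Rightarrow> real" where "star \<equiv> antipode \<l> \<gamma>"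

lemma normal_orthogonal_parallel:
  assumes "normal s \<bullet> T t = 0"
  shows "\<exists>c. T t = c *\<^sub>R T s"
  using rot90_expansion[OF T_T, of "T t" s] assms by (auto simp: inner_commute)

lemma height_der: "((\<lambda>t. normal s \<bullet> \<gamma> t) has_real_derivative normal s \<bullet> T t) (at t)"
proof -
  have "((\<lambda>t. normal s) has_vector_derivative 0) (at t)" by simp
  from has_real_derivative_inner[OF this \<gamma>_der] show ?thesis by simp
qed

text \<open>Rolle's theorem for the height over the tangent at \<open>s\<close>, which returns to
  its initial value after one period.\<close>

lemma opposite_exists: "\<exists>t. s < t \<and> t < s + \<l> \<and> (\<exists>c. T t = c *\<^sub>R T s)"
proof -
  have "\<exists>z>s. z < s + \<l> \<and> ((\<lambda>t. normal s \<bullet> \<gamma> t) has_real_derivative 0) (at z)"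
  proof (rule Rolle)
    show "continuous_on {s..s + \<l>} (\<lambda>t. normal s \<bullet> \<gamma> t)"
      by (intro continuous_intros continuous_\<gamma>)
    show "(\<lambda>t. normal s \<bullet> \<gamma> t) differentiable (at x)" for x
      using height_der real_differentiable_def by blast
  qed (use l_pos periodic in auto)
  then obtain z where z: "s < z" "z < s + \<l>"
    "((\<lambda>t. normal s \<bullet> \<gamma> t) has_real_derivative 0) (at z)" by blast
  then have "normal s \<bullet> T z = 0" using height_der DERIV_unique by blast
  then show ?thesis using z normal_orthogonal_parallel by blast
qed

lemma star_ex1: "\<exists>!t. s < t \<and> t < s + \<l> \<and> (\<exists>c. T t = c *\<^sub>R T s)"
  using opposite_exists[of s] opposite_unique[of s] parallel_opposite[of s] by metis

lemma star_gt: "s < star s" and star_less: "star s < s + \<l>"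
  and T_star: "T (star s) = - T s"
proof -
  have "s < star s \<and> star s < s + \<l> \<and> (\<exists>c. T (star s) = c *\<^sub>R T s)"
    unfolding antipode_def by (rule theI'[OF star_ex1])
  then show "s < star s" "star s < s + \<l>" "T (star s) = - T s" using parallel_opposite by blast+
qed

lemma star_eqI:
  assumes "s < t" "t < s + \<l>" "T t = c *\<^sub>R T s"
  shows "t = star s"
  using opposite_unique[OF assms(1,2) parallel_opposite[OF assms] star_gt star_less T_star] .

text \<open>The quantity starts at \<open>0\<close> with derivative \<open>k s > 0\<close>, and a
  later zero means a parallel tangent, which first occurs at the antipode. Since it vanishes at
  \<open>s\<close> itself, the intermediate value argument starts slightly to the right, at
  \<open>s + h\<close>.\<close>

lemma turning_pos:
  assumes "s < t" "t < star s"
  shows "0 < normal s \<bullet> T t"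
proof (rule ccontr)
  assume neg: "\<not> 0 < normal s \<bullet> T t"
  have "((\<lambda>t. normal s \<bullet> T t) has_real_derivative normal s \<bullet> (k s *\<^sub>R normal s) + 0 \<bullet> T s) (at s)"
    by (intro has_real_derivative_inner T_der) simp
  then have "((\<lambda>t. normal s \<bullet> T t) has_real_derivative k s) (at s)" by (simp add: T_T)
  from DERIV_pos_inc_right[OF this] obtain d where d: "0 < d"
    "\<And>h. 0 < h \<Longrightarrow> h < d \<Longrightarrow> normal s \<bullet> T s < normal s \<bullet> T (s + h)"
    using curvature_pos by blast
  define h where "h = min (d / 2) (t - s)"
  have h: "0 < h" "h < d" "s + h \<le> t" using d(1) assms(1) by (auto simp: h_def)
  have "\<exists>x. s + h \<le> x \<and> x \<le> t \<and> normal s \<bullet> T x = 0"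
    using d(2)[OF h(1,2)] neg h(3)
    by (intro IVT2' continuous_intros continuous_T) auto
  then obtain x where x: "s + h \<le> x" "x \<le> t" "normal s \<bullet> T x = 0" by blast
  obtain c where "T x = c *\<^sub>R T s" using normal_orthogonal_parallel[OF x(3)] by blast
  then have "x = star s" using x h assms star_less[of s] by (intro star_eqI) auto
  then show False using x(2) assms(2) by simp
qed

text \<open>This is half the squared length of \<open>T s + T t\<close>, which is zero only for
  opposite tangents.\<close>

lemma denom_pos:
  assumes "s < t" "t < star s"
  shows "0 < 1 + T s \<bullet> T t"
proof -
  have sq: "(T s + T t) \<bullet> (T s + T t) = 2 * (1 + T s \<bullet> T t)"
    by (simp add: inner_add_left inner_add_right T_T inner_commute)
  have "T s + T t \<noteq> 0"
  proof
    assume "T s + T t = 0"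
    then have "T t = (-1) *\<^sub>R T s" by (simp add: eq_neg_iff_add_eq_0 add.commute)
    then show False using star_eqI[of s t "-1"] assms star_less[of s] by auto
  qed
  then have "0 < (T s + T t) \<bullet> (T s + T t)" by simp
  from this[unfolded sq] show ?thesis by simp
qed

lemma T_inner_le: "T s \<bullet> T t \<le> 1"
  using norm_cauchy_schwarz[of "T s" "T t"] T_T by (simp add: norm_eq_sqrt_inner)

section \<open>Existence and uniqueness of the next tangency\<close>

text \<open>The solution \<open>r\<close> of \<open>(\<gamma> s - \<gamma> t) \<bullet> normal t - r
  * (T s \<bullet> T t) = r\<close>: the centre \<open>\<gamma> s - r *\<^sub>R normal s\<close> is
  at distance \<open>r\<close> from the tangent at \<open>t\<close>. It is the earlier
  \<open>radius\<close> with \<open>t\<close> as a parameter instead of an offset.\<close>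

definition tangent_radius :: "real \<Rightarrow> real \<Rightarrow> real" where
  "tangent_radius s t = ((\<gamma> s - \<gamma> t) \<bullet> normal t) / (1 + T s \<bullet> T t)"

lemma gap_pos: "\<gamma> s \<noteq> \<gamma> t \<Longrightarrow> 0 < (\<gamma> s - \<gamma> t) \<bullet> normal t"
  using support_strict[of s t] by (simp add: inner_commute)

text \<open>The chord is a combination of the two tangent vectors with positive coefficients.\<close>

lemma chord_inner_pos:
  assumes "s < t" "t < star s"
  shows "0 < (\<gamma> t - \<gamma> s) \<bullet> (T s + T t)"
proof -
  have neq: "\<gamma> t \<noteq> \<gamma> s" using \<gamma>_neq[OF assms(1)] assms(2) star_less[of s] by simp
  define \<sigma> where "\<sigma> = normal s \<bullet> T t"
  have \<sigma>: "0 < \<sigma>" using turning_pos[OF assms] by (simp add: \<sigma>_def)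
  define c where "c = T s \<bullet> T t"
  define p q where "p = (\<gamma> t - \<gamma> s) \<bullet> T s" and "q = (\<gamma> t - \<gamma> s) \<bullet> normal s"
  have q: "0 < q" using support_strict[OF neq] by (simp add: q_def inner_commute)
  have Tt: "T t = c *\<^sub>R T s + \<sigma> *\<^sub>R normal s"
    using rot90_expansion[OF T_T, of "T t" s] by (simp add: c_def \<sigma>_def inner_commute)
  have nt: "normal t = c *\<^sub>R normal s - \<sigma> *\<^sub>R T s"
    unfolding Tt by (simp add: vec_eq_iff forall_2)
  have unit: "c\<^sup>2 + \<sigma>\<^sup>2 = 1"
    using rot90_pythagoras[OF T_T, of "T t" s] T_T[of t] by (simp add: c_def \<sigma>_def inner_commute)
  have "0 < (\<gamma> s - \<gamma> t) \<bullet> normal t" using neq by (intro gap_pos) auto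
  also have "(\<gamma> s - \<gamma> t) \<bullet> normal t = - ((\<gamma> t - \<gamma> s) \<bullet> normal t)" by (simp add: inner_diff_left)
  also have "(\<gamma> t - \<gamma> s) \<bullet> normal t = c * q - \<sigma> * p" unfolding nt p_def q_def
    by (simp add: inner_diff_right)
  finally have a: "0 < \<sigma> * p - c * q" by simp
  have M: "0 < 1 + c" using denom_pos[OF assms] by (simp add: c_def)
  have "(\<gamma> t - \<gamma> s) \<bullet> (T s + T t) = p + (c * p + \<sigma> * q)"
    unfolding Tt p_def q_def by (simp add: inner_add_right)
  \<comment> \<open>Positivity of \<open>q\<close> and of \<open>\<sigma> * p - c * q\<close> says
    that each endpoint lies inside the tangent at the other. After multiplication by
    \<open>\<sigma>\<close> the claim becomes a positive combination of these two.\<close>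
  then have "\<sigma> * ((\<gamma> t - \<gamma> s) \<bullet> (T s + T t)) = (1 + c) * (\<sigma> * p - c * q) + (c * q + (c\<^sup>2 + \<sigma>\<^sup>2) * q)"
    by (simp add: algebra_simps power2_eq_square)
  also have "\<dots> = (1 + c) * ((\<sigma> * p - c * q) + q)" unfolding unit by (simp add: algebra_simps)
  also have "\<dots> > 0" using M a q by simp
  finally show ?thesis using \<sigma> by (simp add: zero_less_mult_iff)
qed

lemma gap_der': "((\<lambda>t. (\<gamma> s - \<gamma> t) \<bullet> normal t) has_real_derivative
    k t * ((\<gamma> t - \<gamma> s) \<bullet> T t)) (at t)"
proof -
  have "((\<lambda>t. \<gamma> s - \<gamma> t) has_vector_derivative 0 - T t) (at t)"
    by (intro derivative_intros \<gamma>_der)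
  from has_real_derivative_inner[OF this normal_der[of t]]
  show ?thesis by (simp add: inner_diff_left algebra_simps)
qed

lemma denom_der': "((\<lambda>t. 1 + T s \<bullet> T t) has_real_derivative k t * (T s \<bullet> normal t)) (at t)"
proof -
  have "((\<lambda>t. T s) has_vector_derivative 0) (at t)" by simp
  from has_real_derivative_inner[OF this T_der[of t]]
  show ?thesis by (auto intro!: derivative_eq_intros)
qed

lemma tangent_radius_der:
  assumes "s < t" "t < star s"
  shows "(tangent_radius s has_real_derivative
    k t * ((\<gamma> t - \<gamma> s) \<bullet> (T s + T t)) / (1 + T s \<bullet> T t)\<^sup>2) (at t)"
proof -
  have "((\<lambda>t. ((\<gamma> s - \<gamma> t) \<bullet> normal t) / (1 + T s \<bullet> T t)) has_real_derivative
     (k t * ((\<gamma> t - \<gamma> s) \<bullet> T t) * (1 + T s \<bullet> T t)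
       - (\<gamma> s - \<gamma> t) \<bullet> normal t * (k t * (T s \<bullet> normal t)))
     / ((1 + T s \<bullet> T t) * (1 + T s \<bullet> T t))) (at t)"
    using denom_pos[OF assms] by (intro DERIV_divide gap_der' denom_der') auto
  \<comment> \<open>Expanding \<open>T s\<close> in the frame at \<open>t\<close> collapses the
    numerator of the quotient rule to the chord times \<open>T s + T t\<close>.\<close>
  moreover have "(\<gamma> t - \<gamma> s) \<bullet> T s
      = ((\<gamma> t - \<gamma> s) \<bullet> T t) * (T s \<bullet> T t) + ((\<gamma> t - \<gamma> s) \<bullet> normal t) * (T s \<bullet> normal t)"
    by (subst rot90_expansion[OF T_T, of "T s" t]) (simp add: inner_add_right)
  then have "((\<gamma> t - \<gamma> s) \<bullet> T t) * (1 + T s \<bullet> T t) - (\<gamma> s - \<gamma> t) \<bullet> normal t * (T s \<bullet> normal t)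
     = (\<gamma> t - \<gamma> s) \<bullet> (T s + T t)"
    by (simp add: inner_add_right inner_diff_left algebra_simps)
  then have "k t * ((\<gamma> t - \<gamma> s) \<bullet> T t) * (1 + T s \<bullet> T t)
       - (\<gamma> s - \<gamma> t) \<bullet> normal t * (k t * (T s \<bullet> normal t))
     = k t * ((\<gamma> t - \<gamma> s) \<bullet> (T s + T t))"
    by (simp only: right_diff_distrib[symmetric] mult.assoc mult.left_commute[of _ "k t"])
  ultimately show ?thesis unfolding tangent_radius_def[abs_def] by (simp add: power2_eq_square)
qed

lemma tangent_radius_strict_mono:
  assumes "s < t" "t < t'" "t' < star s"
  shows "tangent_radius s t < tangent_radius s t'"
proof (rule DERIV_pos_imp_increasing[OF assms(2)])
  fix x assume "t \<le> x" "x \<le> t'"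
  then have x: "s < x" "x < star s" using assms by auto
  have "0 < k x * ((\<gamma> x - \<gamma> s) \<bullet> (T s + T x)) / (1 + T s \<bullet> T x)\<^sup>2"
    using curvature_pos chord_inner_pos[OF x] denom_pos[OF x] by simp
  then show "\<exists>y. (tangent_radius s has_real_derivative y) (at x) \<and> 0 < y"
    using tangent_radius_der[OF x] by blast
qed

text \<open>The intermediate value theorem is applied to the numerator minus \<open>r\<close> times
  the denominator. Unlike the quotient, this function is continuous up to the antipode, where the
  denominator vanishes and the numerator is positive.\<close>

lemma tangent_radius_eq_exists:
  assumes "0 < r"
  shows "\<exists>t. s < t \<and> t < star s \<and> tangent_radius s t = r"
proof -
  let ?f = "\<lambda>t. (\<gamma> s - \<gamma> t) \<bullet> normal t - r * (1 + T s \<bullet> T t)"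
  have "\<gamma> s \<noteq> \<gamma> (star s)" using \<gamma>_neq[OF star_gt star_less, of s] by simp
  from gap_pos[OF this] have end1: "0 < ?f (star s)" by (simp add: T_star T_T)
  have end0: "?f s < 0" using assms by (simp add: T_T)
  have "\<exists>t\<ge>s. t \<le> star s \<and> ?f t = 0"
    using end0 end1 star_gt[of s]
    by (intro IVT' continuous_intros continuous_\<gamma> continuous_T continuous_normal) auto
  then obtain t where t: "s \<le> t" "t \<le> star s" "?f t = 0" by blast
  then have t': "s < t" "t < star s" using end0 end1 by (auto simp: less_le)
  then show ?thesis using t(3) denom_pos[OF t'] by (auto simp: tangent_radius_def field_simps)
qed

section \<open>Identification of the outer circle\<close>

lemma mem_tangent_line: "p \<in> tangent_line \<gamma> s \<longleftrightarrow> normal s \<bullet> (p - \<gamma> s) = 0"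
proof
  assume "normal s \<bullet> (p - \<gamma> s) = 0"
  then have "p - \<gamma> s = ((p - \<gamma> s) \<bullet> T s) *\<^sub>R T s"
    using rot90_expansion[OF T_T, of "p - \<gamma> s" s] by (simp add: inner_commute)
  then have "p = \<gamma> s + ((p - \<gamma> s) \<bullet> T s) *\<^sub>R T s" by (metis add.commute diff_add_cancel)
  then show "p \<in> tangent_line \<gamma> s" unfolding tangent_line_def by blast
qed (auto simp: tangent_line_def)

lemma tangent_to_circle_tangent_line:
  "0 < r \<Longrightarrow> tangent_to_circle (tangent_line \<gamma> s) c r \<longleftrightarrow> \<bar>(c - \<gamma> s) \<bullet> normal s\<bar> = r"
  unfolding tangent_line_def by (rule tangent_to_circle_iff[OF T_T])

lemma affine_hull_tangent_line:
  assumes P: "P \<in> tangent_line \<gamma> s" "P \<noteq> \<gamma> s"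
  shows "affine hull {P, \<gamma> s} = tangent_line \<gamma> s"
proof -
  obtain a where a: "P = \<gamma> s + a *\<^sub>R T s" using P(1) by (auto simp: tangent_line_def)
  then have a0: "a \<noteq> 0" using P(2) by auto
  show ?thesis
  proof
    show "affine hull {P, \<gamma> s} \<subseteq> tangent_line \<gamma> s"
    proof
      fix z assume "z \<in> affine hull {P, \<gamma> s}"
      then obtain u v where z: "z = u *\<^sub>R P + v *\<^sub>R \<gamma> s" and uv: "u + v = 1"
        by (auto simp: affine_hull_2)
      have "z = (u + v) *\<^sub>R \<gamma> s + (u * a) *\<^sub>R T s" unfolding z by (simp add: a algebra_simps)
      then have "z = \<gamma> s + (u * a) *\<^sub>R T s" using uv by simp
      then show "z \<in> tangent_line \<gamma> s" by (auto simp: tangent_line_def)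
    qed
    show "tangent_line \<gamma> s \<subseteq> affine hull {P, \<gamma> s}"
    proof
      fix z assume "z \<in> tangent_line \<gamma> s"
      then obtain t where t: "z = \<gamma> s + t *\<^sub>R T s" by (auto simp: tangent_line_def)
      have "z = (t / a) *\<^sub>R P + (1 - t / a) *\<^sub>R \<gamma> s" using a0 by (simp add: a t algebra_simps)
      then show "z \<in> affine hull {P, \<gamma> s}" unfolding affine_hull_2
        by (intro CollectI exI[of _ "t / a"] exI[of _ "1 - t / a"]) simp
    qed
  qed
qed

text \<open>Touching at \<open>\<gamma> s\<^sub>1\<close> leaves one centre on either side along the
  normal. The inner one is impossible because its disc contains points of \<open>\<Omega>\<close>
  close to \<open>\<gamma> s\<^sub>1\<close>. For the outer one, tangency to the line through
  \<open>P\<close> and \<open>\<gamma> s\<^sub>0\<close>, which is the tangent at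
  \<open>s\<^sub>0\<close>, fixes the radius.\<close>

lemma outer_circle_iff:
  assumes "s\<^sub>0 < s\<^sub>1" "s\<^sub>1 < star s\<^sub>0"
  shows "outer_circle \<Omega> \<gamma> s\<^sub>0 s\<^sub>1 c r \<longleftrightarrow>
    r = tangent_radius s\<^sub>1 s\<^sub>0 \<and> c = \<gamma> s\<^sub>1 - r *\<^sub>R normal s\<^sub>1"
proof -
  have neq: "\<gamma> s\<^sub>1 \<noteq> \<gamma> s\<^sub>0" using \<gamma>_neq[OF assms(1)] assms(2) star_less[of s\<^sub>0] by simp
  define h where "h = (\<gamma> s\<^sub>1 - \<gamma> s\<^sub>0) \<bullet> normal s\<^sub>0"
  have h: "0 < h" using gap_pos[OF neq] by (simp add: h_def)
  define x where "x = T s\<^sub>1 \<bullet> T s\<^sub>0"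
  have x: "-1 < x" "x \<le> 1" using denom_pos[OF assms] T_inner_le by (auto simp: x_def inner_commute)
  have rad: "tangent_radius s\<^sub>1 s\<^sub>0 = h / (1 + x)" by (simp add: tangent_radius_def h_def x_def)
  have dist0: "(\<gamma> s\<^sub>1 - r *\<^sub>R normal s\<^sub>1 - \<gamma> s\<^sub>0) \<bullet> normal s\<^sub>0 = h - r * x" for r
    by (simp add: h_def x_def inner_diff_left)
  have turn: "0 < normal s\<^sub>0 \<bullet> T s\<^sub>1" by (rule turning_pos[OF assms])
  show ?thesis
  proof
    assume oc: "outer_circle \<Omega> \<gamma> s\<^sub>0 s\<^sub>1 c r"
    then have r: "0 < r" and disj: "cball c r \<inter> \<Omega> = {}"
      and touch: "tangent_line \<gamma> s\<^sub>1 \<inter> sphere c r = {\<gamma> s\<^sub>1}"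
      by (auto simp: outer_circle_def)
    obtain P where P: "tangent_line \<gamma> s\<^sub>0 \<inter> tangent_line \<gamma> s\<^sub>1 = {P}" "P \<noteq> \<gamma> s\<^sub>0"
      "tangent_to_circle (affine hull {P, \<gamma> s\<^sub>0}) c r"
      using oc by (auto simp: outer_circle_def)
    have "tangent_to_circle (tangent_line \<gamma> s\<^sub>1) c r"
      unfolding tangent_to_circle_def touch by blast
    then have d: "\<bar>(c - \<gamma> s\<^sub>1) \<bullet> normal s\<^sub>1\<bar> = r" by (simp add: tangent_to_circle_tangent_line r)
    have "norm (c - \<gamma> s\<^sub>1) = r" using touch by (auto simp: dist_norm)
    then have "r\<^sup>2 = ((c - \<gamma> s\<^sub>1) \<bullet> T s\<^sub>1)\<^sup>2 + ((c - \<gamma> s\<^sub>1) \<bullet> normal s\<^sub>1)\<^sup>2"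
      using rot90_pythagoras[OF T_T, of "c - \<gamma> s\<^sub>1" s\<^sub>1] by (simp add: dot_square_norm)
    moreover have "((c - \<gamma> s\<^sub>1) \<bullet> normal s\<^sub>1)\<^sup>2 = r\<^sup>2" using d by (metis power2_abs)
    ultimately have "(c - \<gamma> s\<^sub>1) \<bullet> T s\<^sub>1 = 0" by simp
    then have c: "c - \<gamma> s\<^sub>1 = ((c - \<gamma> s\<^sub>1) \<bullet> normal s\<^sub>1) *\<^sub>R normal s\<^sub>1"
      using rot90_expansion[OF T_T, of "c - \<gamma> s\<^sub>1" s\<^sub>1] by simp
    have "(c - \<gamma> s\<^sub>1) \<bullet> normal s\<^sub>1 \<noteq> r"
    proof
      assume pos: "(c - \<gamma> s\<^sub>1) \<bullet> normal s\<^sub>1 = r"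
      have c': "c = \<gamma> s\<^sub>1 + r *\<^sub>R normal s\<^sub>1" using c[unfolded pos] by (simp add: algebra_simps)
      have "\<forall>\<^sub>F t in at_right (0::real). t \<in> {0<..<r} \<and> \<gamma> s\<^sub>1 + t *\<^sub>R normal s\<^sub>1 \<in> \<Omega>"
        by (rule eventually_conj[OF eventually_at_right_real[OF r] inward])
      from eventually_happens'[OF trivial_limit_at_right_real this]
      obtain t where t: "0 < t" "t < r" "\<gamma> s\<^sub>1 + t *\<^sub>R normal s\<^sub>1 \<in> \<Omega>" by auto
      have "c - (\<gamma> s\<^sub>1 + t *\<^sub>R normal s\<^sub>1) = (r - t) *\<^sub>R normal s\<^sub>1" by (simp add: c' algebra_simps)
      moreover have "norm (normal s\<^sub>1) = 1" using T_T by (simp add: norm_eq_sqrt_inner)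
      ultimately have "\<gamma> s\<^sub>1 + t *\<^sub>R normal s\<^sub>1 \<in> cball c r" using t by (simp add: dist_norm)
      then show False using t(3) disj by blast
    qed
    then have neg: "(c - \<gamma> s\<^sub>1) \<bullet> normal s\<^sub>1 = - r" using d by (auto simp: abs_if split: if_splits)
    have c': "c = \<gamma> s\<^sub>1 - r *\<^sub>R normal s\<^sub>1" using c[unfolded neg] by (simp add: algebra_simps)
    have "P \<in> tangent_line \<gamma> s\<^sub>0" using P(1) by blast
    then have "tangent_to_circle (tangent_line \<gamma> s\<^sub>0) c r"
      using P affine_hull_tangent_line by metis
    then have "\<bar>(c - \<gamma> s\<^sub>0) \<bullet> normal s\<^sub>0\<bar> = r" by (simp add: tangent_to_circle_tangent_line r)
    then have "\<bar>h - r * x\<bar> = r" unfolding c' dist0 .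
    then have "r = h / (1 + x)" using tangency_radius_iff[OF h r x] by simp
    then show "r = tangent_radius s\<^sub>1 s\<^sub>0 \<and> c = \<gamma> s\<^sub>1 - r *\<^sub>R normal s\<^sub>1" using c' rad by simp
  next
    assume rc: "r = tangent_radius s\<^sub>1 s\<^sub>0 \<and> c = \<gamma> s\<^sub>1 - r *\<^sub>R normal s\<^sub>1"
    then have rh: "r = h / (1 + x)" and c: "c = \<gamma> s\<^sub>1 - r *\<^sub>R normal s\<^sub>1" using rad by auto
    have r: "0 < r" using rh h x(1) by simp
    have nn: "norm (normal s\<^sub>1) = 1" using T_T by (simp add: norm_eq_sqrt_inner)
    \<comment> \<open>The tangent at \<open>s\<^sub>1\<close> separates: the disc has nonpositive
      height over it, the points of \<open>\<Omega>\<close> positive height.\<close>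
    have disj: "cball c r \<inter> \<Omega> = {}"
    proof (rule ccontr)
      assume "cball c r \<inter> \<Omega> \<noteq> {}"
      then obtain z where z: "z \<in> cball c r" "z \<in> \<Omega>" by blast
      have "normal s\<^sub>1 \<bullet> (z - c) \<le> norm (normal s\<^sub>1) * norm (z - c)" by (rule norm_cauchy_schwarz)
      also have "\<dots> \<le> r" using z(1) nn by (simp add: dist_norm norm_minus_commute)
      finally have "normal s\<^sub>1 \<bullet> (z - \<gamma> s\<^sub>1) \<le> 0" unfolding c by (simp add: inner_diff_right T_T)
      then show False using support_interior[OF z(2), of s\<^sub>1] by simp
    qed
    have "tangent_to_circle (tangent_line \<gamma> s\<^sub>1) c r"
      using r by (simp add: tangent_to_circle_tangent_line c T_T)
    moreover have "\<gamma> s\<^sub>1 \<in> tangent_line \<gamma> s\<^sub>1 \<inter> sphere c r"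
      using r nn by (simp add: mem_tangent_line c dist_norm)
    ultimately have touch: "tangent_line \<gamma> s\<^sub>1 \<inter> sphere c r = {\<gamma> s\<^sub>1}"
      unfolding tangent_to_circle_def by blast
    \<comment> \<open>The position on the tangent at \<open>s\<^sub>1\<close> solves
      \<open>h + t * (normal s\<^sub>0 \<bullet> T s\<^sub>1) = 0\<close>, the condition for lying
      on the tangent at \<open>s\<^sub>0\<close>.\<close>
    define P where "P = \<gamma> s\<^sub>1 - (h / (normal s\<^sub>0 \<bullet> T s\<^sub>1)) *\<^sub>R T s\<^sub>1"
    have P1: "P \<in> tangent_line \<gamma> s\<^sub>1" by (simp add: mem_tangent_line P_def)
    have P0: "P \<in> tangent_line \<gamma> s\<^sub>0"
      using turn by (simp add: mem_tangent_line P_def h_def inner_diff_right inner_diff_left inner_commute)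
    have Puniq: "tangent_line \<gamma> s\<^sub>0 \<inter> tangent_line \<gamma> s\<^sub>1 = {P}"
    proof
      show "tangent_line \<gamma> s\<^sub>0 \<inter> tangent_line \<gamma> s\<^sub>1 \<subseteq> {P}"
      proof
        fix q assume q: "q \<in> tangent_line \<gamma> s\<^sub>0 \<inter> tangent_line \<gamma> s\<^sub>1"
        then obtain t where t: "q = \<gamma> s\<^sub>1 + t *\<^sub>R T s\<^sub>1" by (auto simp: tangent_line_def)
        have "normal s\<^sub>0 \<bullet> (q - \<gamma> s\<^sub>0) = 0" using q by (simp add: mem_tangent_line)
        then have "h + t * (normal s\<^sub>0 \<bullet> T s\<^sub>1) = 0"
          by (simp add: t h_def inner_diff_right inner_diff_left inner_add_right inner_commute)
        then have "t = - (h / (normal s\<^sub>0 \<bullet> T s\<^sub>1))" using turn by (simp add: field_simps)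
        then show "q \<in> {P}" by (simp add: t P_def)
      qed
    qed (use P0 P1 in blast)
    have Pne: "P \<noteq> \<gamma> s\<^sub>0"
    proof
      assume "P = \<gamma> s\<^sub>0"
      then have "normal s\<^sub>1 \<bullet> (\<gamma> s\<^sub>0 - \<gamma> s\<^sub>1) = 0" using P1 by (simp add: mem_tangent_line)
      then show False using support_strict[of s\<^sub>0 s\<^sub>1] neq by simp
    qed
    have "\<bar>(c - \<gamma> s\<^sub>0) \<bullet> normal s\<^sub>0\<bar> = r"
      unfolding c dist0 using tangency_radius_iff[OF h r x] rh by simp
    then have "tangent_to_circle (affine hull {P, \<gamma> s\<^sub>0}) c r"
      by (simp add: affine_hull_tangent_line[OF P0 Pne] tangent_to_circle_tangent_line r)
    then show "outer_circle \<Omega> \<gamma> s\<^sub>0 s\<^sub>1 c r"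
      unfolding outer_circle_def using r disj touch Puniq Pne by blast
  qed
qed

lemma tangent_radius_pos:
  assumes "s\<^sub>0 < s\<^sub>1" "s\<^sub>1 < star s\<^sub>0"
  shows "0 < tangent_radius s\<^sub>1 s\<^sub>0" "0 < tangent_radius s\<^sub>0 s\<^sub>1"
proof -
  have neq: "\<gamma> s\<^sub>1 \<noteq> \<gamma> s\<^sub>0" using \<gamma>_neq[OF assms(1)] assms(2) star_less[of s\<^sub>0] by simp
  then show "0 < tangent_radius s\<^sub>1 s\<^sub>0" "0 < tangent_radius s\<^sub>0 s\<^sub>1"
    using gap_pos[OF neq] gap_pos[OF neq[symmetric]] denom_pos[OF assms]
    by (simp_all add: tangent_radius_def inner_commute)
qed

text \<open>With the circle identified, tangency at \<open>s\<^sub>2\<close> is again a distance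
  equation solved by \<open>tangent_radius\<close>. The new line differs from the two old ones
  because a tangent meets the boundary at its contact point only, and
  \<open>\<gamma> s\<^sub>2\<close> is neither \<open>\<gamma> s\<^sub>0\<close> nor
  \<open>\<gamma> s\<^sub>1\<close>.\<close>

lemma next_tangency_iff:
  assumes "s\<^sub>0 < s\<^sub>1" "s\<^sub>1 < star s\<^sub>0"
  shows "next_tangency \<Omega> \<l> \<gamma> s\<^sub>0 s\<^sub>1 s\<^sub>2 \<longleftrightarrow>
    s\<^sub>1 < s\<^sub>2 \<and> s\<^sub>2 < star s\<^sub>1 \<and> tangent_radius s\<^sub>1 s\<^sub>2 = tangent_radius s\<^sub>1 s\<^sub>0"
proof (cases "s\<^sub>1 < s\<^sub>2 \<and> s\<^sub>2 < star s\<^sub>1")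
  case True
  then have s2: "s\<^sub>1 < s\<^sub>2" "s\<^sub>2 < star s\<^sub>1" by auto
  have neq1: "\<gamma> s\<^sub>2 \<noteq> \<gamma> s\<^sub>1" using \<gamma>_neq[OF s2(1)] s2(2) star_less[of s\<^sub>1] by simp
  \<comment> \<open>the tangent at \<open>s\<^sub>0 + \<l>\<close> points to the outer side of the tangent at \<open>s\<^sub>1\<close>\<close>
  have "star s\<^sub>1 \<le> s\<^sub>0 + \<l>"
  proof (rule ccontr)
    assume "\<not> star s\<^sub>1 \<le> s\<^sub>0 + \<l>"
    then have "0 < normal s\<^sub>1 \<bullet> T (s\<^sub>0 + \<l>)"
      using assms star_less[of s\<^sub>0] by (intro turning_pos) auto
    then have "0 < - (normal s\<^sub>0 \<bullet> T s\<^sub>1)"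
      using inner_rot90_swap[of "T s\<^sub>1" "T s\<^sub>0"] by (simp add: T_periodic inner_commute)
    then show False using turning_pos[OF assms] by simp
  qed
  then have neq0: "\<gamma> s\<^sub>2 \<noteq> \<gamma> s\<^sub>0" using \<gamma>_neq[of s\<^sub>0 s\<^sub>2] assms(1) s2 by simp
  have lines: "tangent_line \<gamma> s\<^sub>2 \<noteq> tangent_line \<gamma> s" if "\<gamma> s\<^sub>2 \<noteq> \<gamma> s" for s
  proof
    assume "tangent_line \<gamma> s\<^sub>2 = tangent_line \<gamma> s"
    moreover have "\<gamma> s\<^sub>2 \<in> tangent_line \<gamma> s\<^sub>2" by (simp add: mem_tangent_line)
    ultimately have "normal s \<bullet> (\<gamma> s\<^sub>2 - \<gamma> s) = 0" by (simp add: mem_tangent_line)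
    then show False using support_strict[OF that] by simp
  qed
  define r where "r = tangent_radius s\<^sub>1 s\<^sub>0"
  have r: "0 < r" using tangent_radius_pos[OF assms] by (simp add: r_def)
  have "next_tangency \<Omega> \<l> \<gamma> s\<^sub>0 s\<^sub>1 s\<^sub>2 \<longleftrightarrow>
      tangent_to_circle (tangent_line \<gamma> s\<^sub>2) (\<gamma> s\<^sub>1 - r *\<^sub>R normal s\<^sub>1) r"
    unfolding next_tangency_def outer_circle_iff[OF assms]
    using s2 lines neq0 neq1 by (auto simp: r_def)
  also have "\<dots> \<longleftrightarrow> \<bar>(\<gamma> s\<^sub>1 - \<gamma> s\<^sub>2) \<bullet> normal s\<^sub>2 - r * (T s\<^sub>1 \<bullet> T s\<^sub>2)\<bar> = r"
    by (simp add: tangent_to_circle_tangent_line[OF r] inner_diff_left algebra_simps)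
  also have "\<dots> \<longleftrightarrow> r = tangent_radius s\<^sub>1 s\<^sub>2"
    unfolding tangent_radius_def using denom_pos[OF s2] gap_pos[OF neq1[symmetric]] r T_inner_le
    by (intro tangency_radius_iff) auto
  finally show ?thesis using True by (auto simp: r_def)
next
  case False
  then show ?thesis by (auto simp: next_tangency_def)
qed

lemma next_tangency_unique:
  assumes "next_tangency \<Omega> \<l> \<gamma> s\<^sub>0 s\<^sub>1 t" "next_tangency \<Omega> \<l> \<gamma> s\<^sub>0 s\<^sub>1 t'"
    and "s\<^sub>0 < s\<^sub>1" "s\<^sub>1 < star s\<^sub>0"
  shows "t = t'"
proof -
  have t: "s\<^sub>1 < t" "t < star s\<^sub>1" "s\<^sub>1 < t'" "t' < star s\<^sub>1"
    "tangent_radius s\<^sub>1 t = tangent_radius s\<^sub>1 t'"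
    using assms by (auto simp: next_tangency_iff)
  then show ?thesis
    using tangent_radius_strict_mono[of s\<^sub>1 t t'] tangent_radius_strict_mono[of s\<^sub>1 t' t]
    by (cases t t' rule: linorder_cases) auto
qed

lemma next_tangency_the:
  assumes "s\<^sub>0 < s\<^sub>1" "s\<^sub>1 < star s\<^sub>0"
  defines "s\<^sub>2 \<equiv> THE s. next_tangency \<Omega> \<l> \<gamma> s\<^sub>0 s\<^sub>1 s"
  shows "s\<^sub>1 < s\<^sub>2" "s\<^sub>2 < star s\<^sub>1" "tangent_radius s\<^sub>1 s\<^sub>2 = tangent_radius s\<^sub>1 s\<^sub>0"
proof -
  have "\<exists>t. next_tangency \<Omega> \<l> \<gamma> s\<^sub>0 s\<^sub>1 t"
    using tangent_radius_eq_exists[OF tangent_radius_pos(1)[OF assms(1,2)], of s\<^sub>1]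
    by (simp add: next_tangency_iff[OF assms(1,2)])
  then have "\<exists>!t. next_tangency \<Omega> \<l> \<gamma> s\<^sub>0 s\<^sub>1 t" using next_tangency_unique assms(1,2) by blast
  from theI'[OF this] have "next_tangency \<Omega> \<l> \<gamma> s\<^sub>0 s\<^sub>1 s\<^sub>2" unfolding s\<^sub>2_def .
  then show "s\<^sub>1 < s\<^sub>2" "s\<^sub>2 < star s\<^sub>1" "tangent_radius s\<^sub>1 s\<^sub>2 = tangent_radius s\<^sub>1 s\<^sub>0"
    by (simp_all add: next_tangency_iff[OF assms(1,2)])
qed

section \<open>The billiard map in the coordinates\<close>

lemma jet_periodic:
  assumes "\<And>n s. (D n has_vector_derivative D (Suc n) s) (at s)" "D 0 = \<gamma>"
  shows "D n (s + \<l>) = (D n s :: real^2)"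
proof (induction n arbitrary: s)
  case 0
  then show ?case using periodic assms(2) by simp
next
  case (Suc n)
  have "((\<lambda>t. D n (\<l> + t)) has_vector_derivative D (Suc n) (\<l> + s)) (at s)"
    by (rule has_vector_derivative_shift[OF assms(1)])
  then have "(D n has_vector_derivative D (Suc n) (s + \<l>)) (at s)"
    by (simp add: Suc add.commute[of \<l>])
  then show ?case using assms(1) vector_derivative_unique_at by blast
qed

definition w :: "real \<Rightarrow> real" where
  "w s = k s powr (2/3)"

definition W :: "real \<Rightarrow> real" where
  "W s = (LBINT r=0..s. w r)"

lemma curvature_jet:
  obtains k1 k2 k3 where
    "\<And>s. (k has_real_derivative k1 s) (at s)"
    "\<And>s. (k1 has_real_derivative k2 s) (at s)"
    "\<And>s. (k2 has_real_derivative k3 s) (at s)"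
    "continuous_on UNIV k3"
    "\<And>s. k (s + \<l>) = k s" "\<And>s. k1 (s + \<l>) = k1 s"
    "\<And>s. k2 (s + \<l>) = k2 s" "\<And>s. k3 (s + \<l>) = k3 s"
proof -
  obtain D where D: "D 0 = \<gamma>" "D 1 = T"
    "\<And>n s. (D n has_vector_derivative D (Suc n) s) (at s)" by (rule jet_exists) blast
  note per = jet_periodic[of D, OF D(3,1)]
  \<comment> \<open>The brackets \<open>P m n\<close> are closed under differentiation and vanish
    for \<open>m = n\<close>, and the curvature is \<open>P 2 1\<close>. Its derivatives are thus
    explicit sums of brackets, hence continuous and periodic.\<close>
  define P where "P m n s = D m s \<bullet> rot90 (D n s)" for m n s
  have Pder: "(P m n has_real_derivative P (Suc m) n s + P m (Suc n) s) (at s)" for m n s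
    using has_real_derivative_inner[OF D(3)[of m s]
        bounded_linear.has_vector_derivative[OF bounded_linear_rot90 D(3)[of n s]]]
    by (simp add: P_def[abs_def] add.commute)
  have Pself: "P n n s = 0" for n s by (simp add: P_def)
  have Pper: "P m n (s + \<l>) = P m n s" for m n s by (simp add: P_def per)
  have k: "k = P 2 1"
  proof
    fix s
    have "(T has_vector_derivative D 2 s) (at s)"
      using D(3)[of 1 s] D(2) by (simp add: numeral_2_eq_2)
    then show "k s = P 2 1 s" unfolding curvature_def P_def D(2) by (simp add: vector_derivative_at)
  qed
  show thesis
  proof
    show "(k has_real_derivative P 3 1 s) (at s)" for s
      unfolding k using Pder[of 2 1 s] Pself[of 2 s] by (simp add: eval_nat_numeral)
    show "(P 3 1 has_real_derivative P 4 1 s + P 3 2 s) (at s)" for s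
      using Pder[of 3 1 s] by (simp add: eval_nat_numeral)
    show "((\<lambda>s. P 4 1 s + P 3 2 s) has_real_derivative (P 5 1 s + P 4 2 s) + (P 4 2 s + P 3 3 s)) (at s)" for s
      using DERIV_add[OF Pder[of 4 1 s] Pder[of 3 2 s]] by (simp add: eval_nat_numeral)
    have Pc: "continuous_on UNIV (P m n)" for m n
      using Pder by (meson DERIV_isCont continuous_at_imp_continuous_on)
    show "continuous_on UNIV (\<lambda>s. (P 5 1 s + P 4 2 s) + (P 4 2 s + P 3 3 s))"
      by (intro continuous_intros Pc)
  qed (simp_all add: k Pper)
qed

lemma w_pos: "0 < w s"
  using curvature_pos[rule_format, of s] by (simp add: w_def)

lemma W_der:
  assumes "continuous_on UNIV w"
  shows "(W has_real_derivative w s) (at s)"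
proof -
  \<comment> \<open>A symmetric interval with \<open>0\<close> and \<open>s\<close> in its interior,
    so that the one-interval form of the fundamental theorem gives the full derivative also for
    negative \<open>s\<close>.\<close>
  define a where "a = \<bar>s\<bar> + 1"
  have "((\<lambda>u. LBINT y=ereal 0..ereal u. w y) has_vector_derivative w s) (at s within {-a..a})"
    using assms by (intro interval_integral_FTC2) (auto simp: a_def intro: continuous_on_subset)
  moreover have "at s within {-a..a} = at s" by (rule at_within_interior) (auto simp: a_def)
  ultimately show ?thesis
    by (simp add: W_def[abs_def] has_real_derivative_iff_has_vector_derivative zero_ereal_def)
qed

lemma frenet_curve_exists:
  obtains k1 k2 k3 w1 w2 w3 kmin wmin
  where "frenet_curve \<gamma> T normal k k1 k2 k3 w w1 w2 w3 W kmin wmin"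
proof -
  obtain k1 k2 k3 where d: "\<And>s. (k has_real_derivative k1 s) (at s)"
    "\<And>s. (k1 has_real_derivative k2 s) (at s)" "\<And>s. (k2 has_real_derivative k3 s) (at s)"
    and c3: "continuous_on UNIV k3"
    and p: "\<And>s. k (s + \<l>) = k s" "\<And>s. k1 (s + \<l>) = k1 s"
    "\<And>s. k2 (s + \<l>) = k2 s" "\<And>s. k3 (s + \<l>) = k3 s"
    by (rule curvature_jet) blast
  have kp: "0 < k s" for s using curvature_pos by blast
  have k0: "k s \<noteq> 0" for s using kp[of s] by simp
  have c: "continuous_on UNIV k" "continuous_on UNIV k1" "continuous_on UNIV k2"
    using d by (meson DERIV_isCont continuous_at_imp_continuous_on)+
  \<comment> \<open>All powers of the curvature at once: differentiation lowers the exponent by one,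
    so a single rule serves \<open>w\<close> and its derivatives.\<close>
  define q where "q a s = k s powr a" for a s
  have qder: "(q a has_real_derivative a * q (a - 1) s * k1 s) (at s)" for a s
    unfolding q_def[abs_def] using DERIV_fun_powr[OF d(1) kp, of a s] by (simp add: mult_ac)
  have qc: "continuous_on UNIV (q a)" for a
    using qder by (meson DERIV_isCont continuous_at_imp_continuous_on)
  have qp: "q a (s + \<l>) = q a s" for a s by (simp add: q_def p)
  have w: "w = q (2/3)" by (simp add: w_def[abs_def] q_def[abs_def])
  define w1 where "w1 s = 2/3 * q (-1/3) s * k1 s" for s
  define w2 where "w2 s = 2/3 * ((-1/3) * q (-4/3) s * k1 s * k1 s + q (-1/3) s * k2 s)" for s
  define w3 where "w3 s = 2/3 * ((-1/3) * ((-4/3) * q (-7/3) s * k1 s * k1 s * k1 s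
      + q (-4/3) s * (2 * k1 s * k2 s)) + ((-1/3) * q (-4/3) s * k1 s * k2 s + q (-1/3) s * k3 s))" for s
  have wd: "(w has_real_derivative w1 s) (at s)" for s
    using qder[of "2/3" s] by (simp add: w w1_def)
  have w1d: "(w1 has_real_derivative w2 s) (at s)" for s
    unfolding w1_def[abs_def] w2_def
    by (rule derivative_eq_intros qder d refl | simp add: algebra_simps)+
  have w2d: "(w2 has_real_derivative w3 s) (at s)" for s
    unfolding w2_def[abs_def] w3_def
    by (rule derivative_eq_intros qder d refl | simp add: algebra_simps)+
  have wc: "continuous_on UNIV w" "continuous_on UNIV w1" "continuous_on UNIV w2" "continuous_on UNIV w3"
    unfolding w w1_def[abs_def] w2_def[abs_def] w3_def[abs_def]
    by (intro continuous_intros qc c c3)+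
  note bd = periodic_bounded_fun[OF _ l_pos]
  obtain kmin where kmin: "0 < kmin" "\<And>s. kmin \<le> k s"
    by (rule periodic_pos_lower_bound[of k \<l>, OF p(1) l_pos c(1) kp]) blast
  have wper: "w (s + \<l>) = w s" for s by (simp add: w qp)
  obtain wmin where wmin: "0 < wmin" "\<And>s. wmin \<le> w s"
    by (rule periodic_pos_lower_bound[of w \<l>, OF wper l_pos wc(1) w_pos]) blast
  show thesis
  proof (rule that[of k1 k2 k3 w1 w2 w3 kmin wmin], unfold_locales)
    show "(W has_real_derivative w s) (at s)" for s by (rule W_der[OF wc(1)])
    show "bounded_fun k" "bounded_fun k1" "bounded_fun k2" "bounded_fun k3"
      by (rule bd[OF p(1) c(1)] bd[OF p(2) c(2)] bd[OF p(3) c(3)] bd[OF p(4) c3])+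
    show "bounded_fun w" by (rule bd[OF wper wc(1)])
    show "bounded_fun w1" by (rule bd[OF _ wc(2)]) (simp add: w1_def qp p)
    show "bounded_fun w2" by (rule bd[OF _ wc(3)]) (simp add: w2_def qp p)
    show "bounded_fun w3" by (rule bd[OF _ wc(4)]) (simp add: w3_def qp p)
    show "3 * w1 s * k s = 2 * w s * k1 s" for s
    proof -
      have "q (2/3) s = q (-1/3) s * k s"
        using powr_add[of "k s" "-1/3" 1] kp[of s] by (simp add: q_def)
      then show ?thesis by (simp add: w w1_def)
    qed
  qed (use \<gamma>_der T_der normal_der T_T d wd w1d w2d kmin wmin in auto)
qed

lemma x_coord_eq: "x_coord \<l> \<gamma> s = W s / W \<l>"
  by (simp add: x_coord_def W_def w_def)

lemma outer_length_map_normal_form: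
  "inj_on (xy_coords \<l> \<gamma>) (phase_space \<l> \<gamma>) \<and>
    (\<exists>C \<delta>. 0 < \<delta> \<and>
      (\<forall>p\<in>phase_space \<l> \<gamma>. \<forall>x y x' y'.
         xy_coords \<l> \<gamma> p = (x, y) \<longrightarrow>
         xy_coords \<l> \<gamma> (outer_length_map \<Omega> \<l> \<gamma> p) = (x', y') \<longrightarrow>
         x' = x + y \<and> (y < \<delta> \<longrightarrow> \<bar>y' - y\<bar> \<le> C * y ^ 4)))"
proof -
  obtain k1 k2 k3 w1 w2 w3 kmin wmin
    where fc: "frenet_curve \<gamma> T normal k k1 k2 k3 w w1 w2 w3 W kmin wmin"
    by (rule frenet_curve_exists) blast
  interpret frenet_curve \<gamma> T normal k k1 k2 k3 w w1 w2 w3 W kmin wmin by (rule fc)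
  have mono: "W s < W t" if "s < t" for s t
  proof -
    have "0 < wmin * (t - s)" using wmin(1) that by simp
    then show ?thesis using disp_lower(1)[of "t - s" s] that by (simp add: disp_def)
  qed
  have "W 0 = 0" by (simp add: W_def zero_ereal_def)
  then have L: "0 < W \<l>" using mono[OF l_pos] by simp
  define L where "L = W \<l>"
  have L: "0 < L" using L by (simp add: L_def)
  have x: "x_coord \<l> \<gamma> s = W s / L" for s by (simp add: x_coord_eq L_def)
  have W_inj: "s = t" if "W s = W t" for s t
    using mono[of s t] mono[of t s] that by (cases s t rule: linorder_cases) auto
  have inj: "inj_on (xy_coords \<l> \<gamma>) (phase_space \<l> \<gamma>)"
  proof (rule inj_onI, clarify)
    fix s \<epsilon> s' \<epsilon>'
    assume "xy_coords \<l> \<gamma> (s, \<epsilon>) = xy_coords \<l> \<gamma> (s', \<epsilon>')"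
    then have "W s = W s'" "W (s + \<epsilon>) - W s = W (s' + \<epsilon>') - W s'"
      using L by (auto simp: xy_coords_def y_coord_def x diff_divide_distrib[symmetric])
    then have "s = s'" "s + \<epsilon> = s' + \<epsilon>'" by (auto intro: W_inj)
    then show "s = s' \<and> \<epsilon> = \<epsilon>'" by simp
  qed
  obtain C \<delta> where \<delta>: "0 < \<delta>" and C: "0 \<le> C"
    and est: "\<And>s t\<^sub>0 t\<^sub>2. 0 < t\<^sub>0 \<Longrightarrow> t\<^sub>0 < \<delta> \<Longrightarrow> 0 < t\<^sub>2 \<Longrightarrow> radius s t\<^sub>2 = radius s (- t\<^sub>0) \<Longrightarrow>
       (\<And>t. 0 < t \<Longrightarrow> t \<le> t\<^sub>2 \<Longrightarrow> radius s t \<le> radius s t\<^sub>2) \<Longrightarrow>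
       \<bar>disp s t\<^sub>2 + disp s (- t\<^sub>0)\<bar> \<le> C * t\<^sub>0 ^ 4"
    by (rule equal_radius_disp) blast
  have rad: "radius s t = tangent_radius s (s + t)" for s t
    by (simp add: radius_def tangent_radius_def gap_def denom_def)
  \<comment> \<open>From \<open>wmin * \<epsilon> \<le> L * y\<close>: the fourth power converts a
    bound in \<open>\<epsilon>\<close> into one in \<open>y\<close>, and the last division
    normalises the coordinate. The same inequality makes \<open>y < \<delta> * wmin / L\<close>
    imply \<open>\<epsilon> < \<delta>\<close>.\<close>
  define C' where "C' = C * (L / wmin) ^ 4 / L"
  have main: "x' = x + y \<and> (y < \<delta> * wmin / L \<longrightarrow> \<bar>y' - y\<bar> \<le> C' * y ^ 4)"
    if p: "p \<in> phase_space \<l> \<gamma>" and xy: "xy_coords \<l> \<gamma> p = (x, y)"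
      and xy': "xy_coords \<l> \<gamma> (outer_length_map \<Omega> \<l> \<gamma> p) = (x', y')" for p x y x' y'
  proof -
    obtain s0 \<epsilon> where pe: "p = (s0, \<epsilon>)" by (cases p)
    define s1 where "s1 = s0 + \<epsilon>"
    have s1: "s0 < s1" "s1 < star s0" using p by (auto simp: pe phase_space_def s1_def)
    define s2 where "s2 = (THE s. next_tangency \<Omega> \<l> \<gamma> s0 s1 s)"
    have s2: "s1 < s2" "s2 < star s1" "tangent_radius s1 s2 = tangent_radius s1 s0"
      unfolding s2_def by (rule next_tangency_the[OF s1])+
    have map: "outer_length_map \<Omega> \<l> \<gamma> p = (s1, s2 - s1)"
      by (simp add: outer_length_map_def pe s1_def s2_def Let_def)
    have y: "y = (W s1 - W s0) / L" and x0: "x = W s0 / L"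
      using xy by (auto simp: xy_coords_def y_coord_def x pe s1_def diff_divide_distrib)
    have y': "y' = (W s2 - W s1) / L" and x': "x' = W s1 / L"
      using xy' by (auto simp: xy_coords_def y_coord_def x map diff_divide_distrib)
    have "\<bar>y' - y\<bar> \<le> C' * y ^ 4" if small: "y < \<delta> * wmin / L"
    proof -
      have e: "0 < \<epsilon>" using s1 by (simp add: s1_def)
      have s0: "s0 = s1 - \<epsilon>" by (simp add: s1_def)
      have "wmin * \<epsilon> \<le> - disp s1 (- \<epsilon>)" by (rule disp_lower(2)[OF e])
      then have ly: "wmin * \<epsilon> \<le> L * y" using L by (simp add: y disp_def s0)
      have "L * y < \<delta> * wmin" using small L by (simp add: field_simps)
      then have "wmin * \<epsilon> < wmin * \<delta>" using ly by (simp add: mult.commute)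
      then have "\<epsilon> < \<delta>" using wmin(1) by simp
      then have "\<bar>disp s1 (s2 - s1) + disp s1 (- \<epsilon>)\<bar> \<le> C * \<epsilon> ^ 4"
      proof (rule est[OF e])
        show "0 < s2 - s1" using s2 by simp
        show "radius s1 (s2 - s1) = radius s1 (- \<epsilon>)" using s2(3) by (simp add: rad s0)
        fix t assume "0 < t" "t \<le> s2 - s1"
        then show "radius s1 t \<le> radius s1 (s2 - s1)"
          using tangent_radius_strict_mono[of s1 "s1 + t" s2] s2(2)
          by (cases "t = s2 - s1") (auto simp: rad)
      qed
      \<comment> \<open>Seen from \<open>s1\<close>, the old step is a backward displacement, so the
        difference of the two coordinates is a sum of displacements.\<close>
      moreover have "y' - y = (disp s1 (s2 - s1) + disp s1 (- \<epsilon>)) / L"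
        by (simp add: y y' disp_def s0 diff_divide_distrib add_divide_distrib)
      ultimately have "\<bar>y' - y\<bar> \<le> C * \<epsilon> ^ 4 / L"
        using L by (simp add: divide_right_mono)
      also have "\<dots> \<le> C * (L / wmin * y) ^ 4 / L"
      proof -
        have "\<epsilon> \<le> L / wmin * y" using ly wmin(1) by (simp add: field_simps)
        then have "\<epsilon> ^ 4 \<le> (L / wmin * y) ^ 4" using e by (intro power_mono) auto
        then show ?thesis using C L by (intro divide_right_mono mult_left_mono) auto
      qed
      also have "\<dots> = C' * y ^ 4" by (simp add: C'_def power_mult_distrib power_divide)
      finally show ?thesis .
    qed
    then show ?thesis using x0 x' y by (simp add: diff_divide_distrib)
  qed
  have "0 < \<delta> * wmin / L" using \<delta> wmin(1) L by simp
  with inj main show ?thesis by blast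
qed

end

theorem lemma12:
  fixes \<Omega> :: "(real^2) set" and \<l> :: real and \<gamma> :: "real \<Rightarrow> real^2"
  assumes "open \<Omega>" and "\<Omega> \<noteq> {}" and "connected \<Omega>" and "bounded \<Omega>"
    and "strictly_convex \<Omega>"
    and "ccw_arclength_boundary \<Omega> \<l> \<gamma>"
    and "\<forall>s. 0 < curvature \<gamma> s"
  shows "inj_on (xy_coords \<l> \<gamma>) (phase_space \<l> \<gamma>) \<and>
    (\<exists>C \<delta>. 0 < \<delta> \<and>
      (\<forall>p\<in>phase_space \<l> \<gamma>. \<forall>x y x' y'.
         xy_coords \<l> \<gamma> p = (x, y) \<longrightarrow>
         xy_coords \<l> \<gamma> (outer_length_map \<Omega> \<l> \<gamma> p) = (x', y') \<longrightarrow>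
         x' = x + y \<and> (y < \<delta> \<longrightarrow> \<bar>y' - y\<bar> \<le> C * y ^ 4)))"
proof -
  interpret convex_boundary \<Omega> \<l> \<gamma> using assms by unfold_locales auto
  show ?thesis by (rule outer_length_map_normal_form)
qed

end
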